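(* Let $\alpha>0$ and $\rho\in(0,1)$. Assume that $\alpha\notin\mathcal L\cup\mathbb Q$. Then for $|z|<1$ and $|\arg(z)|<\pi$ $$\phi(z;\alpha,\rho)=\exp\left[\sum_{k\ge1}\frac{\sin(\pi k\rho)}{k\sin\left(\frac{\pi k}{\alpha}\right)}(-1)^kz^k+\sum_{k\ge1}\frac{\sin(\pi k\alpha\rho)}{k\sin(\pi k\alpha)}(-1)^kz^{\alpha k}\right].$$
   Context: $\mathcal L$ is the set of $x\in\mathbb R\setminus\mathbb Q$ for which there exist $b>1$ and $c>0$ such that $\left|x-\frac pq\right|<\frac{c}{b^q}$ for infinitely many pairs of coprime integers $p$ and $q$ (with $q>0$). Powers are principal: $z^{a}=e^{a\ln z}$. Definition of $\phi$. The admissible set is $\mathcal A=\{\alpha\in(0,1),\rho\in(0,1)\}\cup\{\alpha=1,\rho=\frac12\}\cup\{\alpha\in(1,2),\rho\in[1-\alpha^{-1},\alpha^{-1}]\}$. For $(\alpha,\rho)\in\mathcal A$, let $X_t$ be the stable Lévy process with $X_0=0$, $\mathbb E[e^{izX_t}]=e^{-t\Psi(z)}$, $z\in\mathbb R$, $\Psi(z)=e^{\pi i\gamma/2}|z|^\alpha$ for $z>0$, $\Psi(z)=e^{-\pi i\gamma/2}|z|^\alpha$ for $z<0$, $\gamma=\alpha(1-2\rho)$; then $\phi(z;\alpha,\rho)=\mathbb E[e^{-zS_{e(1)}}]$ for $\mathrm{Re}(z)\ge0$, where $S_t=\sup_{0\le u\le t}X_u$ and $e(1)$ is an independent unit-mean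 exponential variable. For general $\alpha>0$, $\rho\in(0,1)$ the function is extended by analytic continuation in the parameters: for $z>0$, $$\phi(z;\alpha,\rho)=\exp\left(\int_0^z\frac{1}{2\pi iu}\left[F(\pi i\rho-\ln u;i/\alpha)-F(-\pi i\rho-\ln u;i/\alpha)\right]du\right),\quad F(w;i/\alpha)=\int_{\mathbb R}\frac{dx}{(1+e^{w-x/\alpha})(1+e^x)}\ (|\mathrm{Im}\,w|<\pi),$$ which agrees with the probabilistic definition when $(\alpha,\rho)\in\mathcal A$; for complex $z$ with $|\arg z|<\pi$, $\phi$ denotes the analytic (meromorphic) continuation in $z$. *)

theory Defs
  imports "HOL-Complex_Analysis.Complex_Analysis"
begin

definition liouville_exp :: "real set" where
  "liouville_exp = {x. x \<notin> \<rat> \<and> (\<exists>b>1. \<exists>c>0.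
     infinite {(p :: int, q :: nat). q > 0 \<and> coprime p (int q) \<and>
       \<bar>x - real_of_int p / real q\<bar> < c / b ^ q})}"

(* F(w; i/\<alpha>); the integral converges absolutely for \<alpha> > 0 and \<bar>Im w\<bar> < pi. *)
definition F_int :: "real \<Rightarrow> complex \<Rightarrow> complex" where
  "F_int \<alpha> w = (LINT x|lborel.
     1 / ((1 + exp (w - complex_of_real (x / \<alpha>))) * (1 + exp (complex_of_real x))))"

definition phi_pos :: "real \<Rightarrow> real \<Rightarrow> real \<Rightarrow> complex" where
  "phi_pos \<alpha> \<rho> z = exp (LINT u:{0<..<z}|lborel.
     1 / (2 * of_real pi * \<i> * of_real u) *
       (F_int \<alpha> (of_real pi * \<i> * of_real \<rho> - of_real (ln u)) -
        F_int \<alpha> (- of_real pi * \<i> * of_real \<rho> - of_real (ln u))))"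

(* For \<alpha> > 0 and 0 < \<rho> < 1: the meromorphic continuation of phi_pos from the positive
   half-line to the slit plane. The notion "nicely meromorphic" (removable singularities
   removed, value 0 at poles) makes the continuation unique as a function, so that the
   description operator is well defined; off the slit plane the value is meaningless.
   For admissible parameters phi is the Laplace transform of the supremum of the stable
   process at an independent unit-mean exponential time. *)
definition phi :: "real \<Rightarrow> real \<Rightarrow> complex \<Rightarrow> complex" where
  "phi \<alpha> \<rho> z = (THE v. \<exists>f. f nicely_meromorphic_on (- \<real>\<^sub>\<le>\<^sub>0) \<and>
     (\<forall>x>0. f (of_real x) = phi_pos \<alpha> \<rho> x) \<and> v = f z)"

end

theory Submission
  imports Defs
begin

text \<open>
  Let \<open>E\<close> be the logarithm of a double sine function, given by the Mellin--Barnes integral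
  \[ E(w) = - \frac{\pi}{2} \int \frac{e^{-sw}}{s \sin(\pi s) \sin(\pi s/\alpha)}\,dt,
     \qquad s = c + it,\quad 0 < c < \min(1, \alpha), \]
  which is holomorphic for \<open>\<bar>Im w\<bar> < \<pi> + \<pi>/\<alpha>\<close> and vanishes as \<open>Re w \<rightarrow> \<infinity>\<close>. Expanding one
  factor of the integrand of \<open>F_int\<close> as a Mellin integral and exchanging the integrals shows
  that \<open>F_int \<alpha>\<close> is the derivative of \<open>E\<close> (\<open>F_int_eq_log_dsine'\<close>), hence, for \<open>x > 0\<close>,
  \[ 2 \pi i \ln \phi(x) = E(-\pi i \rho - \ln x) - E(\pi i \rho - \ln x). \]

  Shifting \<open>w\<close> multiplies \<open>e^{-sw}\<close> by an exponential. Subtracting two shifts cancels one of the two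
  sines, and what remains is an elementary integral (\<open>log_dsine_shift\<close>):
  \[ E(w + \pi i) - E(w - \pi i) = 2 \pi i \ln (1 + e^{-\alpha w}), \qquad
     E(w + \pi i/\alpha) - E(w - \pi i/\alpha) = 2 \pi i \ln (1 + e^{-w}). \]
  These two difference equations do all the work.

  The series. When \<open>\<alpha>\<close> is neither rational nor in the exceptional set, for every \<open>b > 1\<close> the
  numbers \<open>\<bar>sin (\<pi>k\<alpha>)\<bar>\<close> and \<open>\<bar>sin (\<pi>k/\<alpha>)\<bar>\<close> are at least a positive multiple of \<open>b^{-k}\<close>, so that
  the series
  \[ \sum_{k \ge 1} \frac{\pi (-1)^k}{k \sin(\pi k/\alpha)} e^{-kw}
     + \sum_{k \ge 1} \frac{\pi (-1)^k}{k \sin(\pi k\alpha)} e^{-\alpha kw} \]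
  converges for \<open>Re w > 0\<close>. Termwise it satisfies the same two difference equations. Its difference
  from \<open>E\<close> therefore has the two periods \<open>2\<pi>i\<close> and \<open>2\<pi>i/\<alpha>\<close>, whose ratio is irrational, within a strip
  of width exactly the sum of the periods. That forces it to be constant on vertical segments, hence
  constant, hence \<open>0\<close> (\<open>holomorphic_two_periods_eq_0\<close>, \<open>log_dsine_series\<close>).
  Inserting the series into the formula for \<open>ln \<phi>(x)\<close> gives the claim for \<open>0 < x < 1\<close>.

  The continuation. The function \<open>phi\<close> is defined through a meromorphic function on the whole slit
  plane, so the existence of one must be shown, also for \<open>\<bar>z\<bar> \<ge> 1\<close>. In \<open>Q = exp (E / (2\<pi>i))\<close> the
  first difference equation reads \<open>Q(w + \<pi>i) = Q(w - \<pi>i) (1 + e^{-\<alpha>w})\<close>. It continues \<open>Q\<close> upwards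
  and \<open>1/Q\<close> downwards holomorphically across the lines \<open>Im w = \<pi>\<close> and \<open>Im w = -\<pi>\<close>, far enough for
  \<open>\<phi>(z) = Q(-\<pi>i\<rho> - ln z) / Q(\<pi>i\<rho> - ln z)\<close> to be the reciprocal of a holomorphic function on the
  slit plane (\<open>phi_pos_nicely_meromorphic_extension\<close>). The identity theorem then gives both the
  uniqueness of the continuation and the formula on the slit unit disc.
\<close>

section \<open>Bilateral Laplace transforms\<close>

lemma integrable_exp_neg_abs:
  fixes r :: real
  assumes "r > 0"
  shows "integrable lborel (\<lambda>x::real. exp (- r * \<bar>x\<bar>))"
proof -
  let ?g = "\<lambda>x::real. indicat_real {0..} x *\<^sub>R exp (- r * x)"
  have "(\<lambda>x. exp (- r * x)) absolutely_integrable_on {0..}"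
    using integrable_on_exp_minus_to_infinity[OF assms, of 0]
    by (subst absolutely_integrable_on_iff_nonneg) auto
  hence g: "integrable lborel ?g"
    unfolding set_integrable_def by (subst (asm) integrable_completion) auto
  hence "integrable lborel (\<lambda>x. ?g (0 + (-1) * x))"
    by (rule lborel_integrable_real_affine) auto
  with g have "integrable lborel (\<lambda>x. ?g x + ?g (0 + (-1) * x))"
    by (rule Bochner_Integration.integrable_add)
  thus ?thesis
    by (rule Bochner_Integration.integrable_bound) (auto simp: indicator_def intro!: AE_I2)
qed

lemma integrable_exp_decay:
  fixes f :: "real \<Rightarrow> complex"
  assumes "f \<in> borel_measurable borel" "r > 0" "\<And>x. norm (f x) \<le> A * exp (- r * \<bar>x\<bar>)"
  shows "integrable lborel f"
proof (rule Bochner_Integration.integrable_bound)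
  show "integrable lborel (\<lambda>x. A * exp (- r * \<bar>x\<bar>))"
    using integrable_exp_neg_abs[OF assms(2)] by simp
  have "norm (f x) \<le> norm (A * exp (- r * \<bar>x\<bar>))" for x
    using assms(3)[of x] by (smt (verit) real_norm_def)
  thus "AE x in lborel. norm (f x) \<le> norm (A * exp (- r * \<bar>x\<bar>))" by simp
qed (use assms in simp)

lemma norm_exp_mult_le:
  fixes w :: complex and x :: real
  shows "norm (exp (w * of_real x)) \<le> exp (\<bar>Re w\<bar> * \<bar>x\<bar>)"
proof -
  have "Re w * x \<le> \<bar>Re w * x\<bar>" by simp
  thus ?thesis by (simp add: abs_mult)
qed

lemma integrable_bilateral_Laplace:
  fixes k :: "real \<Rightarrow> complex"
  assumes [measurable]: "k \<in> borel_measurable borel"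
    and bound: "\<And>x. norm (k x) \<le> A * exp (- B * \<bar>x\<bar>)"
    and w: "\<bar>Re w\<bar> < B"
  shows "integrable lborel (\<lambda>x. k x * exp (w * of_real x))"
proof (rule integrable_exp_decay)
  show "0 < B - \<bar>Re w\<bar>" using w by simp
  fix x :: real
  have "norm (k x * exp (w * of_real x)) \<le> (A * exp (- B * \<bar>x\<bar>)) * exp (\<bar>Re w\<bar> * \<bar>x\<bar>)"
    unfolding norm_mult by (intro mult_mono bound norm_exp_mult_le order_trans[OF norm_ge_zero bound]) auto
  thus "norm (k x * exp (w * of_real x)) \<le> A * exp (- (B - \<bar>Re w\<bar>) * \<bar>x\<bar>)"
    by (simp add: mult_exp_exp algebra_simps)
qed simp

lemma norm_exp_minus_1_le:
  fixes u :: complex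
  shows "norm (exp u - 1) \<le> norm u * exp (norm u)"
proof -
  have "norm (exp u - exp 0) \<le> exp (norm u) * norm (u - 0)"
  proof (rule field_differentiable_bound[where S = "cball 0 (norm u)"])
    fix z :: complex assume "z \<in> cball 0 (norm u)"
    hence "Re z \<le> norm u" using complex_Re_le_cmod[of z] by simp
    thus "norm (exp z) \<le> exp (norm u)" by simp
  qed (auto intro!: derivative_eq_intros)
  thus ?thesis by (simp add: mult.commute)
qed

text \<open>
  Dominated convergence for the difference quotients: within distance \<open>\<delta>\<close> of \<open>w\<close>, a third of the
  distance to the boundary of the strip, the factor \<open>\<bar>x\<bar>\<close> and the displacement cost a factor
  \<open>exp (\<delta>\<bar>x\<bar>)\<close> each and leave the integrable bound \<open>exp (-\<delta>\<bar>x\<bar>)\<close>.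
\<close>
lemma has_field_derivative_bilateral_Laplace:
  fixes k :: "real \<Rightarrow> complex"
  assumes [measurable]: "k \<in> borel_measurable borel"
    and bound: "\<And>x. norm (k x) \<le> A * exp (- B * \<bar>x\<bar>)"
    and w: "\<bar>Re w\<bar> < B"
  shows "((\<lambda>w. LINT x|lborel. k x * exp (w * of_real x)) has_field_derivative
           (LINT x|lborel. of_real x * k x * exp (w * of_real x))) (at w)"
proof -
  define \<delta> where "\<delta> = (B - \<bar>Re w\<bar>) / 3"
  have \<delta>: "\<delta> > 0" using w by (simp add: \<delta>_def)
  let ?L = "\<lambda>w. LINT x|lborel. k x * exp (w * of_real x)"
  have "A * exp (- B * \<bar>0\<bar>) \<ge> 0" by (rule order_trans[OF norm_ge_zero bound])
  hence A: "A \<ge> 0" by simp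
  have int: "integrable lborel (\<lambda>x. k x * exp (v * of_real x))" if "norm (v - w) < \<delta>" for v
  proof (rule integrable_bilateral_Laplace[OF assms(1,2)])
    have "\<bar>Re v\<bar> \<le> \<bar>Re w\<bar> + norm (v - w)"
      using abs_Re_le_cmod[of "v - w"] by auto
    thus "\<bar>Re v\<bar> < B" using that \<delta> unfolding \<delta>_def by argo
  qed
  have "((\<lambda>h. (?L (w + h) - ?L w) / h) \<longlongrightarrow> (LINT x|lborel. of_real x * k x * exp (w * of_real x))) (at 0)"
    unfolding tendsto_at_iff_sequentially comp_def
  proof (intro allI impI)
    fix X :: "nat \<Rightarrow> complex" 
    assume X: "\<forall>i. X i \<in> UNIV - {0}" and X0: "X \<longlonglongrightarrow> 0"
    have "eventually (\<lambda>i. norm (X i) < \<delta>) sequentially"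
      using X0 \<delta> by (auto dest!: tendstoD simp: dist_norm)
    then obtain N where N: "\<And>i. i \<ge> N \<Longrightarrow> norm (X i) < \<delta>"
      by (auto simp: eventually_sequentially)
    define Y where "Y = (\<lambda>i. X (i + N))"
    have Y: "norm (Y i) < \<delta>" "Y i \<noteq> 0" for i using N X by (auto simp: Y_def)
    have Y0: "Y \<longlonglongrightarrow> 0" unfolding Y_def using X0 by (rule LIMSEQ_ignore_initial_segment)
    define q where "q = (\<lambda>i (x::real). k x * exp (w * of_real x) * ((exp (Y i * of_real x) - 1) / Y i))"
    have "(?L (w + Y i) - ?L w) / Y i = (LINT x|lborel. q i x)" for i
    proof -
      have "?L (w + Y i) - ?L w = (LINT x|lborel. k x * exp ((w + Y i) * of_real x) - k x * exp (w * of_real x))"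
        by (rule Bochner_Integration.integral_diff[symmetric]) (intro int; use Y \<delta> in simp)+
      also have "\<dots> / Y i = (LINT x|lborel. (k x * exp ((w + Y i) * of_real x) - k x * exp (w * of_real x)) / Y i)"
        by simp
      also have "\<dots> = (LINT x|lborel. q i x)"
        by (simp add: q_def algebra_simps exp_add diff_divide_distrib)
      finally show ?thesis .
    qed
    moreover have "(\<lambda>i. LINT x|lborel. q i x) \<longlonglongrightarrow> (LINT x|lborel. of_real x * k x * exp (w * of_real x))"
    proof (rule integral_dominated_convergence)
      show "integrable lborel (\<lambda>x. A / \<delta> * exp (- \<delta> * \<bar>x\<bar>))"
        using integrable_exp_neg_abs[OF \<delta>] by simp
      show "AE x in lborel. (\<lambda>i. q i x) \<longlonglongrightarrow> of_real x * k x * exp (w * of_real x)"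
      proof (rule AE_I2)
        fix x :: real
        have "((\<lambda>h. exp (h * of_real x)) has_field_derivative of_real x) (at (0::complex))"
          by (auto intro!: derivative_eq_intros)
        hence "((\<lambda>h. (exp (h * of_real x) - 1) / h) \<longlongrightarrow> of_real x) (at (0::complex))"
          by (simp add: DERIV_def)
        hence "(\<lambda>i. (exp (Y i * of_real x) - 1) / Y i) \<longlonglongrightarrow> of_real x"
          unfolding tendsto_at_iff_sequentially comp_def using Y Y0 by auto
        hence "(\<lambda>i. q i x) \<longlonglongrightarrow> k x * exp (w * of_real x) * of_real x"
          unfolding q_def by (intro tendsto_intros)
        thus "(\<lambda>i. q i x) \<longlonglongrightarrow> of_real x * k x * exp (w * of_real x)"
          by (simp add: mult_ac)
      qed
      show "AE x in lborel. norm (q i x) \<le> A / \<delta> * exp (- \<delta> * \<bar>x\<bar>)" for i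
      proof (rule AE_I2)
        fix x :: real
        have "norm (exp (Y i * of_real x) - 1) \<le> norm (Y i * of_real x) * exp (norm (Y i * of_real x))"
          by (rule norm_exp_minus_1_le)
        also have "\<dots> \<le> (norm (Y i) * \<bar>x\<bar>) * exp (\<delta> * \<bar>x\<bar>)"
          using less_imp_le[OF Y(1)[of i]] \<delta> by (auto intro!: mult_mono simp: norm_mult)
        finally have "norm ((exp (Y i * of_real x) - 1) / Y i) \<le> \<bar>x\<bar> * exp (\<delta> * \<bar>x\<bar>)"
          using Y(2)[of i] by (simp add: norm_divide field_simps)
        moreover have "\<delta> * \<bar>x\<bar> \<le> exp (\<delta> * \<bar>x\<bar>)"
          using exp_ge_add_one_self[of "\<delta> * \<bar>x\<bar>"] by linarith
        hence "\<bar>x\<bar> * exp (\<delta> * \<bar>x\<bar>) \<le> exp (\<delta> * \<bar>x\<bar>) / \<delta> * exp (\<delta> * \<bar>x\<bar>)"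
          using \<delta> by (intro mult_right_mono) (auto simp: field_simps)
        ultimately have 1: "norm ((exp (Y i * of_real x) - 1) / Y i) \<le> exp (\<delta> * \<bar>x\<bar>) / \<delta> * exp (\<delta> * \<bar>x\<bar>)"
          by linarith
        have "norm (q i x) \<le> (A * exp (- B * \<bar>x\<bar>)) * exp (\<bar>Re w\<bar> * \<bar>x\<bar>) * (exp (\<delta> * \<bar>x\<bar>) / \<delta> * exp (\<delta> * \<bar>x\<bar>))"
          unfolding q_def norm_mult
          by (intro mult_mono bound norm_exp_mult_le 1 order_trans[OF norm_ge_zero bound] mult_nonneg_nonneg) (use A in auto)
        also have "\<dots> = A / \<delta> * exp (- B * \<bar>x\<bar> + \<bar>Re w\<bar> * \<bar>x\<bar> + \<delta> * \<bar>x\<bar> + \<delta> * \<bar>x\<bar>)"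
          unfolding exp_add by (simp add: mult_ac)
        also have "- B * \<bar>x\<bar> + \<bar>Re w\<bar> * \<bar>x\<bar> + \<delta> * \<bar>x\<bar> + \<delta> * \<bar>x\<bar> = - \<delta> * \<bar>x\<bar>"
          unfolding \<delta>_def by (simp add: field_simps)
        finally show "norm (q i x) \<le> A / \<delta> * exp (- \<delta> * \<bar>x\<bar>)" .
      qed
    qed (auto simp: q_def)
    ultimately have "(\<lambda>i. (?L (w + X (i + N)) - ?L w) / X (i + N)) \<longlonglongrightarrow> (LINT x|lborel. of_real x * k x * exp (w * of_real x))"
      unfolding Y_def by simp
    thus "(\<lambda>i. (?L (w + X i) - ?L w) / X i) \<longlonglongrightarrow> (LINT x|lborel. of_real x * k x * exp (w * of_real x))"
      by (rule LIMSEQ_offset)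
  qed
  thus ?thesis by (simp add: DERIV_def)
qed

section \<open>The Mellin transform pair of the logistic function\<close>

text \<open>
  This is \<open>\<bar>sin z\<bar>\<^sup>2 = sin\<^sup>2 x + sinh\<^sup>2 y \<ge> sin\<^sup>2 x cosh\<^sup>2 y\<close>. It makes the reciprocal of a sine decay
  exponentially along vertical lines that avoid its zeros.
\<close>
lemma norm_sin_ge:
  fixes z :: complex
  shows "\<bar>sin (Re z)\<bar> * exp \<bar>Im z\<bar> / 2 \<le> norm (sin z)"
proof (rule power2_le_imp_le)
  define E where "E = exp \<bar>Im z\<bar>"
  have E: "E > 0" "exp (2 * Im z) + inverse (exp (2 * Im z)) = E\<^sup>2 + inverse (E\<^sup>2)"
    by (auto simp: E_def exp_minus[symmetric] power2_eq_square mult_exp_exp abs_if)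
  define S where "S = (sin (Re z))\<^sup>2"
  have S: "0 \<le> S" "S \<le> 1" "cos (2 * Re z) = 1 - 2 * S"
    by (auto simp: S_def cos_double_sin abs_square_le_1)
  have 1: "(norm (sin z))\<^sup>2 = (E\<^sup>2 + inverse (E\<^sup>2) - 2 + 4 * S) / 4"
    unfolding norm_sin_squared S(3) E(2) by simp
  have "E\<^sup>2 + inverse (E\<^sup>2) - 2 = (E - inverse E)\<^sup>2"
    using E(1) by (simp add: power2_diff power_inverse)
  hence "S * (E\<^sup>2 + inverse (E\<^sup>2) - 2) \<le> 1 * (E\<^sup>2 + inverse (E\<^sup>2) - 2)"
    using S by (intro mult_right_mono) auto
  moreover have "0 \<le> S * inverse (E\<^sup>2)" using S E by simp
  ultimately have "S * E\<^sup>2 \<le> E\<^sup>2 + inverse (E\<^sup>2) - 2 + 4 * S"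
    using S(1) unfolding ring_distribs by linarith
  thus "(\<bar>sin (Re z)\<bar> * exp \<bar>Im z\<bar> / 2)\<^sup>2 \<le> (norm (sin z))\<^sup>2"
    unfolding 1 by (simp add: power_mult_distrib power_divide S_def E_def)
qed auto

lemma norm_inverse_sin_le:
  fixes z :: complex
  assumes "sin (Re z) > 0"
  shows "norm (1 / sin z) \<le> 2 / sin (Re z) * exp (- \<bar>Im z\<bar>)" "sin z \<noteq> 0"
proof -
  have 1: "sin (Re z) * exp \<bar>Im z\<bar> / 2 \<le> norm (sin z)"
    using norm_sin_ge[of z] assms by simp
  have 2: "0 < sin (Re z) * exp \<bar>Im z\<bar> / 2" using assms by simp
  show "sin z \<noteq> 0" using 1 2 by auto
  have "1 / norm (sin z) \<le> 1 / (sin (Re z) * exp \<bar>Im z\<bar> / 2)"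
    by (rule divide_left_mono[OF 1]) (use 1 2 in \<open>auto intro!: mult_pos_pos\<close>)
  thus "norm (1 / sin z) \<le> 2 / sin (Re z) * exp (- \<bar>Im z\<bar>)"
    by (simp add: norm_divide exp_minus field_simps)
qed

text \<open>
  Up to the factor \<open>1/2\<close> the hyperbolic secant of \<open>x/2\<close>. Writing \<open>e^{sx} / (1 + e^x)\<close> as
  \<open>e^{(s - 1/2)x}\<close> times this even function puts the integral into the symmetric form of a bilateral
  Laplace transform.
\<close>
definition sech_half :: "real \<Rightarrow> real" where
  "sech_half x = 1 / (exp (x / 2) + exp (- x / 2))"

lemma sech_half_bound: "0 < sech_half x" "sech_half x \<le> exp (- (1/2) * \<bar>x\<bar>)"
proof -
  show "0 < sech_half x" by (simp add: sech_half_def add_pos_pos)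
  have "exp (\<bar>x\<bar> / 2) \<le> exp (x / 2) + exp (- x / 2)" by (cases "x \<ge> 0") auto
  hence "sech_half x \<le> 1 / exp (\<bar>x\<bar> / 2)"
    unfolding sech_half_def by (intro divide_left_mono mult_pos_pos add_pos_pos) auto
  thus "sech_half x \<le> exp (- (1/2) * \<bar>x\<bar>)" by (simp add: exp_minus inverse_eq_divide)
qed

lemma measurable_sech_half [measurable]: "sech_half \<in> borel_measurable borel"
  unfolding sech_half_def by measurable

lemma exp_mult_sech_half:
  "exp (u * of_real x) * of_real (sech_half x) = exp ((u + 1/2) * of_real x) / (1 + exp (of_real x) :: complex)"
proof -
  define E where "E = exp (complex_of_real x / 2)"
  have "E \<noteq> 0" by (simp add: E_def)
  have E1: "exp (of_real x) = E * E" by (simp add: E_def mult_exp_exp)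
  have "complex_of_real (exp (x/2) + exp (-x/2)) \<noteq> 0"
    by (subst of_real_eq_0_iff) (smt (verit) exp_gt_zero)
  moreover have "complex_of_real (exp (x/2) + exp (-x/2)) = E + inverse E"
    unfolding E_def exp_minus[symmetric] of_real_add exp_of_real[symmetric] by simp
  ultimately have "E + inverse E \<noteq> 0" by metis
  moreover have "1 + E * E = (E + inverse E) * E"
    using \<open>E \<noteq> 0\<close> by (simp add: algebra_simps)
  ultimately have nz: "1 + E * E \<noteq> 0" using \<open>E \<noteq> 0\<close> by simp
  have "complex_of_real (sech_half x) = 1 / (E + inverse E)"
    using \<open>complex_of_real (exp (x/2) + exp (-x/2)) = E + inverse E\<close> by (simp add: sech_half_def)
  also have "\<dots> = E / (1 + E * E)"
    using nz \<open>E \<noteq> 0\<close> \<open>E + inverse E \<noteq> 0\<close> by (simp add: divide_simps)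
  finally show ?thesis unfolding E1 by (simp add: E_def exp_add[symmetric] algebra_simps)
qed

text \<open>
  The substitution \<open>t = 1 / (1 + e^{-x})\<close> turns the integral into \<open>Beta s (1 - s)\<close>, which the
  reflection formula of the Gamma function evaluates.
\<close>
lemma integral_exp_sech_half_real:
  fixes s :: real
  assumes s: "0 < s" "s < 1"
  shows "(LINT x|lborel. exp ((s - 1/2) * x) * sech_half x) = pi / sin (pi * s)"
proof -
  define g where "g = (\<lambda>x::real. 1 / (1 + exp (- x)))"
  define f where "f = (\<lambda>t::real. t powr (s - 1) * (1 - t) powr (- s))"
  have e1: "1 + exp x \<noteq> 0" "1 + exp x > 0" for x :: real 
    by (smt (verit) exp_gt_zero)+
  have g01: "0 < g x" "g x < 1" "1 - g x = 1 / (1 + exp x)" "g x = exp x / (1 + exp x)" for x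
    using e1[of x] e1[of "-x"] by (auto simp: g_def field_simps exp_minus)
  have fg: "f (g x) * (g x * (1 - g x)) = exp ((s - 1/2) * x) * sech_half x" for x
  proof -
    have "f (g x) * (g x * (1 - g x)) = g x powr s * (1 - g x) powr (1 - s)"
      using g01(1,2)[of x] by (simp add: f_def powr_diff powr_minus field_simps)
    also have "g x powr s = exp (s * x) / (1 + exp x) powr s"
      unfolding g01(4) using e1[of x] by (simp add: powr_divide powr_def[of "exp x"])
    also have "(1 - g x) powr (1 - s) = 1 / (1 + exp x) powr (1 - s)"
      unfolding g01(3) using e1[of x] by (simp add: powr_divide)
    also have "exp (s * x) / (1 + exp x) powr s * (1 / (1 + exp x) powr (1 - s)) = exp (s * x) / (1 + exp x)"
      using e1[of x] by (simp add: powr_add[symmetric])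
    also have "complex_of_real \<dots> = complex_of_real (exp ((s - 1/2) * x) * sech_half x)"
      using exp_mult_sech_half[of "of_real (s - 1/2)" x] by (simp add: exp_of_real[symmetric])
    hence "exp (s * x) / (1 + exp x) = exp ((s - 1/2) * x) * sech_half x"
      using of_real_eq_iff by blast
    finally show ?thesis .
  qed
  have cint: "integrable lborel (\<lambda>x. complex_of_real (sech_half x) * exp (of_real (s - 1/2) * of_real x))"
  proof (rule integrable_bilateral_Laplace[where A = 1 and B = "1/2"])
    show "\<bar>Re (complex_of_real (s - 1 / 2))\<bar> < 1 / 2" using s by (simp add: abs_if)
  qed (use sech_half_bound in \<open>auto simp: less_imp_le\<close>)
  have int: "integrable lborel (\<lambda>x. exp ((s - 1/2) * x) * sech_half x)"
    using integrable_Re[OF cint] by (simp add: Re_exp mult.commute)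
  have "(LBINT x=0..1. f x) = (LBINT x=-\<infinity>..\<infinity>. f (g x) * (g x * (1 - g x)))"
    unfolding zero_ereal_def one_ereal_def
  proof (rule interval_integral_substitution_nonneg(2))
    show "DERIV g x :> g x * (1 - g x)" for x
      unfolding g_def using e1[of "-x"]
      by (auto intro!: derivative_eq_intros simp: field_simps power2_eq_square)
    show "isCont f (g x)" for x
      unfolding f_def using g01[of x] by (intro continuous_intros) auto
    show "isCont (\<lambda>x. g x * (1 - g x)) x" for x
      unfolding g_def using e1[of "-x"] by (intro continuous_intros) auto
    show "0 \<le> f (g x)" "0 \<le> g x * (1 - g x)" for x
      using g01[of x] by (auto simp: f_def)
    show "set_integrable lborel (einterval (-\<infinity>) \<infinity>) (\<lambda>x. f (g x) * (g x * (1 - g x)))"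
      unfolding fg using int by (simp add: set_integrable_def)
    have "(g \<longlongrightarrow> 1 / (1 + 0)) at_top"
      unfolding g_def by (intro tendsto_intros filterlim_compose[OF exp_at_bot] filterlim_uminus_at_bot_at_top) auto
    thus "((ereal \<circ> g \<circ> real_of_ereal) \<longlongrightarrow> ereal 1) (at_left \<infinity>)"
      by (simp add: ereal_tendsto_simps)
    have "filterlim (\<lambda>x::real. 1 + exp (-x)) at_top at_bot"
      by (intro filterlim_tendsto_add_at_top[OF tendsto_const] filterlim_compose[OF exp_at_top] filterlim_uminus_at_top_at_bot)
    hence "(g \<longlongrightarrow> 0) at_bot"
      unfolding g_def by (intro tendsto_divide_0[OF tendsto_const] filterlim_at_top_imp_at_infinity)
    thus "((ereal \<circ> g \<circ> real_of_ereal) \<longlongrightarrow> ereal 0) (at_right (-\<infinity>))"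
      by (simp add: ereal_tendsto_simps)
  qed auto
  also have "\<dots> = (LINT x|lborel. exp ((s - 1/2) * x) * sech_half x)"
    unfolding fg by (simp add: interval_lebesgue_integral_def set_lebesgue_integral_def)
  also have "(LBINT x=0..1. f x) = Beta s (1 - s)"
  proof -
    have "(LBINT x=0..1. f x) = integral {0..1} f"
      using interval_integral_eq_integral[of 0 1 f] integrable_Beta[of s "1 - s"] s
      by (simp add: f_def zero_ereal_def one_ereal_def)
    also have "\<dots> = Beta s (1 - s)"
      using has_integral_Beta_real[of s "1 - s"] s by (simp add: f_def has_integral_iff)
    finally show ?thesis .
  qed
  also have "complex_of_real (Beta s (1 - s)) = of_real (pi / sin (pi * s))"
  proof -
    have "complex_of_real (Beta s (1 - s)) = Gamma (of_real s) * Gamma (1 - of_real s)"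
      using Gamma_complex_of_real[of s] Gamma_complex_of_real[of "1 - s"] by (simp add: Beta_def)
    also have "\<dots> = of_real (pi / sin (pi * s))"
      unfolding Gamma_reflection_complex using sin_of_real[of "pi * s", where 'a = complex] by simp
    finally show ?thesis .
  qed
  hence "Beta s (1 - s) = pi / sin (pi * s)" using of_real_eq_iff by blast
  finally show ?thesis by simp
qed

text \<open>
  Both sides are analytic in \<open>u\<close> and agree on the real interval.
\<close>
lemma integral_exp_sech_half:
  assumes u: "\<bar>Re u\<bar> < 1 / 2"
  shows "(LINT x|lborel. exp (u * of_real x) * of_real (sech_half x)) = of_real pi / cos (of_real pi * u)"
proof -
  define S where "S = {u. \<bar>Re u\<bar> < 1 / 2}"
  define L where "L = (\<lambda>u. LINT x|lborel. complex_of_real (sech_half x) * exp (u * of_real x))"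
  have S: "S = {u. Re u < 1/2} \<inter> {u. Re u > -1/2}" by (auto simp: S_def)
  have oS: "open S" unfolding S by (intro open_Int open_halfspace_Re_lt open_halfspace_Re_gt)
  have cS: "connected S" unfolding S
    by (intro convex_connected convex_Int convex_halfspace_Re_lt convex_halfspace_Re_gt)
  have "(L has_field_derivative (LINT x|lborel. of_real x * complex_of_real (sech_half x) * exp (u * of_real x))) (at u)"
    if "u \<in> S" for u
    unfolding L_def
    by (rule has_field_derivative_bilateral_Laplace[where A = 1 and B = "1/2"])
       (use that sech_half_bound in \<open>auto simp: S_def less_imp_le\<close>)
  hence hL: "L holomorphic_on S"
    using oS by (auto simp: holomorphic_on_open)
  have "L u * cos (of_real pi * u) - of_real pi = 0"
  proof (rule analytic_continuation[where f = "\<lambda>u. L u * cos (of_real pi * u) - of_real pi" and S = S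
        and U = "of_real ` {-1/2<..<1/2}" and \<xi> = 0])
    show "(\<lambda>u. L u * cos (of_real pi * u) - of_real pi) holomorphic_on S"
      by (intro holomorphic_intros hL)
    show "complex_of_real ` {-1/2<..<1/2} \<subseteq> S" "0 \<in> S" "u \<in> S" using u by (auto simp: S_def)
    have "0 islimpt {-1/2<..<1/2::real}" by (rule open_imp_islimpt) auto
    thus "(0::complex) islimpt complex_of_real ` {-1/2<..<1/2}"
      using islimpt_isCont_image[of 0 "{-1/2<..<1/2}" complex_of_real] by (auto simp: eventually_at_filter)
    fix z assume "z \<in> complex_of_real ` {-1/2<..<1/2}"
    then obtain r where r: "z = of_real r" "-1/2 < r" "r < 1/2" by auto
    have "L z = of_real (LINT x|lborel. exp ((r + 1/2 - 1/2) * x) * sech_half x)"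
      unfolding L_def r by (subst integral_complex_of_real[symmetric]) (simp add: exp_of_real[symmetric] mult_ac)
    also have "\<dots> = of_real (pi / sin (pi * (r + 1/2)))"
      by (subst integral_exp_sech_half_real) (use r in auto)
    also have "sin (pi * (r + 1/2)) = cos (pi * r)"
      by (simp add: sin_cos_eq algebra_simps)
    finally have Lz: "L z = of_real (pi / cos (pi * r))" .
    have "cos (pi * r) > 0"
      by (rule cos_gt_zero_pi) (use r mult_strict_left_mono[of "-1/2" r pi] mult_strict_left_mono[of r "1/2" pi] in auto)
    thus "L z * cos (of_real pi * z) - of_real pi = 0"
      unfolding Lz using cos_of_real[of "pi * r", where 'a = complex] by (simp add: r)
  qed (use oS cS in auto)
  hence *: "L u * cos (of_real pi * u) = of_real pi" by simp
  hence "cos (of_real pi * u) \<noteq> 0" by auto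
  with * have "L u = of_real pi / cos (of_real pi * u)" by (simp add: field_simps)
  thus ?thesis by (simp add: L_def mult.commute)
qed

text \<open>
  The line of integration may be moved where the integrand is holomorphic. A primitive \<open>H\<close> exists on
  the strip, so the two integrals over \<open>[-R, R]\<close> differ by increments of \<open>H\<close> along the two horizontal
  segments at heights \<open>R\<close> and \<open>-R\<close>, which tend to \<open>0\<close>.
\<close>
lemma vertical_line_integrals_eq:
  fixes h :: "complex \<Rightarrow> complex"
  assumes hol: "h holomorphic_on {s. a < Re s \<and> Re s < b}"
    and cd: "a < c" "c \<le> d" "d < b" and B: "B > 0"
    and bound: "\<And>s. c \<le> Re s \<Longrightarrow> Re s \<le> d \<Longrightarrow> norm (h s) \<le> A * exp (- B * \<bar>Im s\<bar>)"
  shows "(LINT t|lborel. h (Complex c t)) = (LINT t|lborel. h (Complex d t))"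
proof -
  define S where "S = {s. a < Re s \<and> Re s < b}"
  have S: "S = {s. Re s < b} \<inter> {s. Re s > a}" by (auto simp: S_def)
  have oS: "open S" unfolding S by (intro open_Int open_halfspace_Re_lt open_halfspace_Re_gt)
  have cS: "convex S" unfolding S
    by (intro convex_Int convex_halfspace_Re_lt convex_halfspace_Re_gt)
  obtain H where H: "\<And>s. s \<in> S \<Longrightarrow> (H has_field_derivative h s) (at s)"
    using holomorphic_convex_primitive'[OF cS oS hol[folded S_def]] oS by (metis at_within_open)
  have cont: "continuous_on UNIV (\<lambda>t. h (Complex x t))" if "a < x" "x < b" for x
    using holomorphic_on_imp_continuous_on[OF hol]
    by (rule continuous_on_compose2) (use that in \<open>auto intro!: continuous_intros simp: Complex_eq\<close>)
  have int: "integrable lborel (\<lambda>t. h (Complex x t))" if "c \<le> x" "x \<le> d" for x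
  proof (rule integrable_exp_decay[OF _ B])
    show "(\<lambda>t. h (Complex x t)) \<in> borel_measurable borel"
      using cont[of x] that cd by (intro borel_measurable_continuous_onI) auto
    show "norm (h (Complex x t)) \<le> A * exp (- B * \<bar>t\<bar>)" for t
      using bound[of "Complex x t"] that by simp
  qed
  have ftc: "integral {- R..R} (\<lambda>t. h (Complex x t)) = (H (Complex x R) - H (Complex x (- R))) / \<i>"
    if "a < x" "x < b" "R \<ge> 0" for x R
  proof -
    have "((\<lambda>t. h (Complex x t)) has_integral H (Complex x R) / \<i> - H (Complex x (- R)) / \<i>) {-R..R}"
    proof (rule fundamental_theorem_of_calculus)
      fix t assume "t \<in> {-R..R}"
      have "((\<lambda>t. H (of_real x + \<i> * of_real t) / \<i>) has_vector_derivative (h (Complex x t) * \<i> / \<i>)) (at t within {-R..R})"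
        by (rule has_vector_derivative_at_within,
            rule has_vector_derivative_real_field, 
            rule derivative_eq_intros, rule DERIV_chain'[where g = H])
           (use H[of "Complex x t"] that in \<open>auto intro!: derivative_eq_intros simp: S_def Complex_eq\<close>)
      thus "((\<lambda>t. H (Complex x t) / \<i>) has_vector_derivative h (Complex x t)) (at t within {-R..R})"
        by (simp only: Complex_eq nonzero_mult_div_cancel_right complex_i_not_zero not_False_eq_True)
    qed (use that in simp)
    thus ?thesis by (simp add: has_integral_iff algebra_simps)
  qed
  have lim: "((\<lambda>R. integral {-R..R} (\<lambda>t. h (Complex x t))) \<longlongrightarrow> (LINT t|lborel. h (Complex x t))) at_top"
    if "c \<le> x" "x \<le> d" for x
  proof -
    have eq: "integral {-R..R} (\<lambda>t. h (Complex x t)) = (LINT t|lborel. indicator {-R..R} t *\<^sub>R h (Complex x t))" for R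
      using set_borel_integral_eq_integral(2)[of "{-R..R}" "\<lambda>t. h (Complex x t)"] int[OF that]
      by (simp add: set_lebesgue_integral_def set_integrable_def integrable_mult_indicator)
    show ?thesis unfolding eq
    proof (rule integral_dominated_convergence_at_top)
      show "integrable lborel (\<lambda>t. norm (h (Complex x t)))" using int[OF that] by simp
      show "AE t in lborel. ((\<lambda>R. indicat_real {-R..R} t *\<^sub>R h (Complex x t)) \<longlongrightarrow> h (Complex x t)) at_top"
      proof (rule AE_I2)
        fix t :: real
        have "eventually (\<lambda>R. indicat_real {-R..R} t *\<^sub>R h (Complex x t) = h (Complex x t)) at_top"
          using eventually_ge_at_top[of "\<bar>t\<bar>"] by eventually_elim (auto simp: indicator_def)
        thus "((\<lambda>R. indicat_real {-R..R} t *\<^sub>R h (Complex x t)) \<longlongrightarrow> h (Complex x t)) at_top"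
          by (rule tendsto_eventually)
      qed
      show "\<forall>\<^sub>F R in at_top. AE t in lborel. norm (indicat_real {-R..R} t *\<^sub>R h (Complex x t)) \<le> norm (h (Complex x t))"
        by (auto simp: indicator_def)
    qed (use int[OF that] in auto)
  qed
  have Hdiff: "norm (H (Complex d t) - H (Complex c t)) \<le> A * exp (- B * \<bar>t\<bar>) * (d - c)" for t
  proof -
    have "norm (H (Complex d t) - H (Complex c t)) \<le> A * exp (- B * \<bar>t\<bar>) * norm (Complex d t - Complex c t)"
    proof (rule field_differentiable_bound[where S = "closed_segment (Complex c t) (Complex d t)"])
      fix z assume z: "z \<in> closed_segment (Complex c t) (Complex d t)"
      then obtain u where u: "0 \<le> u" "u \<le> 1" "z = (1 - u) *\<^sub>R Complex c t + u *\<^sub>R Complex d t"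
        by (auto simp: closed_segment_def)
      have "Im z = t" by (simp add: u algebra_simps)
      have "Re z = c + u * (d - c)" by (simp add: u algebra_simps)
      moreover have "0 \<le> u * (d - c)" "u * (d - c) \<le> 1 * (d - c)"
        using u cd mult_right_mono[of u 1 "d - c"] by auto
      ultimately have "c \<le> Re z" "Re z \<le> d" by auto
      thus "norm (h z) \<le> A * exp (- B * \<bar>t\<bar>)" using bound[of z] \<open>Im z = t\<close> by simp
      show "(H has_field_derivative h z) (at z within closed_segment (Complex c t) (Complex d t))"
        by (rule has_field_derivative_at_within, rule H) (use \<open>c \<le> Re z\<close> \<open>Re z \<le> d\<close> cd in \<open>auto simp: S_def\<close>)
    qed auto
    also have "Complex d t - Complex c t = of_real (d - c)" by (simp add: Complex_eq)
    also have "norm \<dots> = d - c" using cd unfolding norm_of_real by simp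
    finally show ?thesis .
  qed
  have "((\<lambda>R. integral {-R..R} (\<lambda>t. h (Complex d t)) - integral {-R..R} (\<lambda>t. h (Complex c t))) \<longlongrightarrow> 0) at_top"
  proof (rule Lim_null_comparison)
    show "\<forall>\<^sub>F R in at_top. norm (integral {-R..R} (\<lambda>t. h (Complex d t)) - integral {-R..R} (\<lambda>t. h (Complex c t)))
             \<le> 2 * A * (d - c) * exp (- (B * R))"
      using eventually_ge_at_top[of 0]
    proof eventually_elim
      case (elim R)
      have "integral {-R..R} (\<lambda>t. h (Complex d t)) - integral {-R..R} (\<lambda>t. h (Complex c t))
          = ((H (Complex d R) - H (Complex c R)) - (H (Complex d (-R)) - H (Complex c (-R)))) / \<i>"
        by (subst (1 2) ftc) (use cd elim in \<open>auto simp: algebra_simps\<close>)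
      also have "norm \<dots> \<le> norm (H (Complex d R) - H (Complex c R)) + norm (H (Complex d (-R)) - H (Complex c (-R)))"
        unfolding norm_divide norm_ii div_by_1 by (rule norm_triangle_ineq4)
      also have "\<dots> \<le> 2 * A * (d - c) * exp (- (B * R))"
        using Hdiff[of R] Hdiff[of "-R"] elim by (simp add: algebra_simps)
      finally show ?case .
    qed
    have "((\<lambda>R. exp (- (B * R))) \<longlongrightarrow> 0) at_top"
      by (intro filterlim_compose[OF exp_at_bot] filterlim_compose[OF filterlim_uminus_at_bot_at_top]
            filterlim_tendsto_pos_mult_at_top[OF tendsto_const B] filterlim_ident)
    from tendsto_mult_right_zero[OF this]
    show "((\<lambda>R. 2 * A * (d - c) * exp (- (B * R))) \<longlongrightarrow> 0) at_top" by simp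
  qed
  moreover have "((\<lambda>R. integral {-R..R} (\<lambda>t. h (Complex d t)) - integral {-R..R} (\<lambda>t. h (Complex c t))) \<longlongrightarrow>
      (LINT t|lborel. h (Complex d t)) - (LINT t|lborel. h (Complex c t))) at_top"
    by (intro tendsto_diff lim) (use cd in auto)
  ultimately have "(LINT t|lborel. h (Complex d t)) - (LINT t|lborel. h (Complex c t)) = 0"
    using tendsto_unique trivial_limit_at_top_linorder by blast
  thus ?thesis by simp
qed

text \<open>
  On the line \<open>Re s = 1/2\<close> the sine becomes a hyperbolic cosine, and the claim is that the
  hyperbolic secant is, up to scaling, its own Fourier transform: the inversion of the preceding
  transform needs no inversion theorem.
\<close>
lemma integral_exp_over_sin_half:
  assumes v: "\<bar>Im v\<bar> < pi"
  shows "(LINT t|lborel. exp (- Complex (1/2) t * v) / sin (of_real pi * Complex (1/2) t)) = 2 / (1 + exp v)"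
proof -
  define u where "u = - \<i> * v / (2 * of_real pi)"
  have u: "\<bar>Re u\<bar> < 1 / 2" using v by (simp add: u_def field_simps)
  have cosh: "sin (of_real pi * Complex (1/2) t) = of_real (cosh (pi * t))" for t
  proof -
    have "sin (of_real pi * Complex (1/2) t) = sin (of_real pi / 2 + \<i> * of_real (pi * t))"
      by (simp add: Complex_eq algebra_simps)
    also have "\<dots> = cos (\<i> * of_real (pi * t))" by (simp add: sin_add)
    also have "\<dots> = cosh (of_real (pi * t))" by (simp add: cosh_conv_cos)
    also have "\<dots> = of_real (cosh (pi * t))"
      by (simp add: cosh_def scaleR_conv_of_real exp_of_real flip: of_real_minus of_real_mult of_real_add)
    finally show ?thesis .
  qed
  have exps: "exp (- Complex (1/2) t * v) = exp (- v / 2) * exp (u * of_real (0 + 2 * pi * t))" for t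
  proof -
    have "- Complex (1/2) t * v = - v / 2 + u * of_real (0 + 2 * pi * t)"
      by (simp add: Complex_eq u_def algebra_simps)
    thus ?thesis by (simp only: exp_add)
  qed
  have sech: "sech_half (0 + 2 * pi * t) = 1 / (2 * cosh (pi * t))" for t
  proof -
    have "2 * cosh (pi * t) = exp (pi * t) + exp (- (pi * t))" unfolding cosh_field_def by simp
    thus ?thesis by (simp add: sech_half_def)
  qed
  have "of_real pi / cos (of_real pi * u) = (LINT x|lborel. exp (u * of_real x) * of_real (sech_half x))"
    using integral_exp_sech_half[OF u] by simp
  also have "\<dots> = (2 * pi) *\<^sub>R (LINT t|lborel. exp (u * of_real (0 + 2 * pi * t)) * of_real (sech_half (0 + 2 * pi * t)))"
    by (subst lborel_integral_real_affine[where c = "2 * pi" and t = 0]) auto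
  also have "\<dots> = pi *\<^sub>R (LINT t|lborel. exp (u * of_real (0 + 2 * pi * t)) / of_real (cosh (pi * t)))"
  proof -
    have "(\<lambda>t. exp (u * of_real (0 + 2 * pi * t)) * of_real (sech_half (0 + 2 * pi * t))) =
        (\<lambda>t. exp (u * of_real (0 + 2 * pi * t)) / of_real (cosh (pi * t)) / 2)"
      unfolding sech by (simp add: fun_eq_iff)
    thus ?thesis by (simp only: integral_divide_zero) (simp add: scaleR_conv_of_real)
  qed
  finally have "(LINT t|lborel. exp (u * of_real (0 + 2 * pi * t)) / of_real (cosh (pi * t))) = 1 / cos (of_real pi * u)"
    unfolding scaleR_conv_of_real divide_inverse[of "of_real pi"] mult_cancel_left by (simp add: divide_inverse)
  hence "(LINT t|lborel. exp (- Complex (1/2) t * v) / sin (of_real pi * Complex (1/2) t)) = exp (- v / 2) * (1 / cos (of_real pi * u))"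
    unfolding cosh exps by (simp flip: times_divide_eq_right)
  also have "of_real pi * u = - (\<i> * (v / 2))" by (simp add: u_def)
  also have "cos (- (\<i> * (v / 2))) = cosh (v / 2)" by (simp add: cosh_conv_cos)
  also have "exp (- v / 2) * (1 / cosh (v / 2)) = 2 / (1 + exp v)"
  proof -
    have e1: "exp (v / 2) * cosh (v / 2) = (1 + exp v) / 2"
      by (simp add: cosh_def scaleR_conv_of_real distrib_left flip: exp_add)
    have eq: "2 * (exp (v / 2) * cosh (v / 2)) = 1 + exp v" unfolding e1 by simp
    have "exp (- v / 2) * (1 / cosh (v / 2)) = 1 / (exp (v / 2) * cosh (v / 2))"
      using exp_minus_inverse[of "v / 2"] by (simp add: exp_minus inverse_eq_divide)
    also have "\<dots> = 2 / (2 * (exp (v / 2) * cosh (v / 2)))" by simp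
    also have "\<dots> = 2 / (1 + exp v)" by (simp only: eq)
    finally show ?thesis .
  qed
  finally show ?thesis .
qed

text \<open>
  A general abscissa is needed because the double sine integral requires \<open>c < min a b\<close>, which may
  be smaller than \<open>1/2\<close>.
\<close>
lemma integral_exp_over_sin:
  assumes v: "\<bar>Im v\<bar> < pi" and c: "0 < c" "c \<le> 1 / 2"
  shows "(LINT t|lborel. exp (- Complex c t * v) / sin (of_real pi * Complex c t)) = 2 / (1 + exp v)"
proof -
  define h where "h = (\<lambda>s. exp (- s * v) / sin (of_real pi * s))"
  have sin_ge: "sin (pi * c) \<le> sin (pi * x)" "sin (pi * c) > 0" if "c \<le> x" "x \<le> 1/2" for x
  proof -
    have 1: "0 < pi * c" "pi * c \<le> pi * x" "pi * x \<le> pi / 2"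
      using c that mult_left_mono[of x "1/2" pi] by (auto intro: mult_left_mono)
    show "sin (pi * c) \<le> sin (pi * x)"
      by (rule sin_monotone_2pi_le) (use 1 pi_gt_zero in linarith)+
    show "sin (pi * c) > 0"
      by (rule sin_gt_zero) (use 1 pi_gt_zero in linarith)+
  qed
  \<comment> \<open>The bound is uniform in the strip since \<open>sin (\<pi>x)\<close> is increasing on \<open>[c, 1/2]\<close>.\<close>
  have "(LINT t|lborel. h (Complex c t)) = (LINT t|lborel. h (Complex (1/2) t))"
  proof (rule vertical_line_integrals_eq[where a = 0 and b = 1 and B = "pi - \<bar>Im v\<bar>"
           and A = "exp \<bar>Re v\<bar> * (2 / sin (pi * c))"])
    have "sin (of_real pi * s) \<noteq> 0" if "0 < Re s" "Re s < 1" for s :: complex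
      by (rule norm_inverse_sin_le(2)) (use that in \<open>auto intro!: sin_gt_zero\<close>)
    thus "h holomorphic_on {s. 0 < Re s \<and> Re s < 1}"
      unfolding h_def by (intro holomorphic_intros) auto
    fix s :: complex assume s: "c \<le> Re s" "Re s \<le> 1 / 2"
    have "- (Re s * Re v - Im s * Im v) \<le> \<bar>Re s * Re v\<bar> + \<bar>Im s * Im v\<bar>" by linarith
    also have "\<dots> \<le> \<bar>Re v\<bar> + \<bar>Im s\<bar> * \<bar>Im v\<bar>"
      using s c mult_right_mono[of "\<bar>Re s\<bar>" 1 "\<bar>Re v\<bar>"] by (simp add: abs_mult)
    finally have "norm (exp (- s * v)) \<le> exp (\<bar>Re v\<bar> + \<bar>Im s\<bar> * \<bar>Im v\<bar>)" by simp
    moreover have "norm (1 / sin (of_real pi * s)) \<le> 2 / sin (pi * c) * exp (- pi * \<bar>Im s\<bar>)"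
    proof -
      have "norm (1 / sin (of_real pi * s)) \<le> 2 / sin (pi * Re s) * exp (- \<bar>pi * Im s\<bar>)"
        using norm_inverse_sin_le(1)[of "of_real pi * s"] sin_ge[OF s] by simp
      also have "\<dots> \<le> 2 / sin (pi * c) * exp (- \<bar>pi * Im s\<bar>)"
        using sin_ge[OF s] by (intro mult_right_mono divide_left_mono mult_pos_pos) auto
      finally show ?thesis by (simp add: abs_mult)
    qed
    ultimately have "norm (exp (- s * v)) * norm (1 / sin (of_real pi * s)) \<le>
        exp (\<bar>Re v\<bar> + \<bar>Im s\<bar> * \<bar>Im v\<bar>) * (2 / sin (pi * c) * exp (- pi * \<bar>Im s\<bar>))"
      by (intro mult_mono) auto
    also have "\<dots> = exp \<bar>Re v\<bar> * (2 / sin (pi * c)) * exp (\<bar>Im s\<bar> * \<bar>Im v\<bar> + - pi * \<bar>Im s\<bar>)"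
      unfolding exp_add by (simp add: mult_ac)
    also have "\<bar>Im s\<bar> * \<bar>Im v\<bar> + - pi * \<bar>Im s\<bar> = - (pi - \<bar>Im v\<bar>) * \<bar>Im s\<bar>"
      by (simp add: algebra_simps)
    finally show "norm (h s) \<le> exp \<bar>Re v\<bar> * (2 / sin (pi * c)) * exp (- (pi - \<bar>Im v\<bar>) * \<bar>Im s\<bar>)"
      by (simp add: h_def norm_divide)
  qed (use v c in auto)
  also have "\<dots> = 2 / (1 + exp v)" unfolding h_def by (rule integral_exp_over_sin_half[OF v])
  finally show ?thesis unfolding h_def .
qed

section \<open>The logarithm of the double sine function\<close>

text \<open>
  With \<open>s = c + it\<close> the integral is \<open>e^{-cw}\<close> times a bilateral Laplace transform at \<open>-\<i>w\<close>, so
  a decay rate \<open>B\<close> of \<open>k\<close> gives holomorphy for \<open>\<bar>Im w\<bar> < B\<close>, and decay as \<open>Re w \<rightarrow> \<infinity>\<close> comes from \<open>c > 0\<close>.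
\<close>
lemma has_field_derivative_vertical_integral:
  fixes k :: "real \<Rightarrow> complex"
  assumes [measurable]: "k \<in> borel_measurable borel"
    and bound: "\<And>t. norm (k t) \<le> A * exp (- B * \<bar>t\<bar>)"
    and w: "\<bar>Im w\<bar> < B"
  shows "((\<lambda>w. LINT t|lborel. k t * exp (- Complex c t * w)) has_field_derivative
           - (LINT t|lborel. Complex c t * k t * exp (- Complex c t * w))) (at w)"
    and "integrable lborel (\<lambda>t. k t * exp (- Complex c t * w))"
    and "norm (LINT t|lborel. k t * exp (- Complex c t * w)) \<le>
           A * (LINT t|lborel. exp (- (B - \<bar>Im w\<bar>) * \<bar>t\<bar>)) * exp (- c * Re w)"
proof -
  define L where "L = (\<lambda>v. LINT t|lborel. k t * exp (v * of_real t))"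
  have split: "exp (- Complex c t * w) = exp (- of_real c * w) * exp ((- \<i> * w) * of_real t)" for t w
    by (simp add: Complex_eq algebra_simps flip: exp_add)
  have eq: "(LINT t|lborel. k t * exp (- Complex c t * w)) = exp (- of_real c * w) * L (- \<i> * w)" for w
    unfolding split L_def by (simp add: mult_ac flip: integral_mult_right_zero)
  define L' where "L' = (LINT t|lborel. of_real t * k t * exp (- \<i> * w * of_real t))"
  have w': "\<bar>Re (- \<i> * w)\<bar> < B" using w by simp
  have int: "integrable lborel (\<lambda>t. k t * exp ((- \<i> * w) * of_real t))"
    by (rule integrable_bilateral_Laplace[OF assms(1) bound w'])
  have "integrable lborel (\<lambda>t. exp (- of_real c * w) * (k t * exp ((- \<i> * w) * of_real t)))"
    using int by (rule integrable_mult_right)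
  thus int': "integrable lborel (\<lambda>t. k t * exp (- Complex c t * w))"
    unfolding split by (simp add: mult_ac)
  have L: "(L has_field_derivative L') (at (- \<i> * w))"
    unfolding L_def L'_def by (rule has_field_derivative_bilateral_Laplace[OF assms(1) bound w'])
  have "((\<lambda>w. exp (- of_real c * w) * L (- \<i> * w)) has_field_derivative
          (exp (- of_real c * w) * (L' * (- \<i>)) + (exp (- of_real c * w) * (- of_real c)) * L (- \<i> * w))) (at w)"
  proof -
    have "((\<lambda>w. L (- \<i> * w)) has_field_derivative L' * (- \<i>)) (at w)"
      by (rule DERIV_chain2[where f = L and g = "\<lambda>w. - \<i> * w", OF L]) (auto intro!: derivative_eq_intros)
    moreover have "((\<lambda>w. exp (- of_real c * w)) has_field_derivative exp (- of_real c * w) * (- of_real c)) (at w)"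
      by (auto intro!: derivative_eq_intros)
    ultimately show ?thesis using DERIV_mult by (subst add.commute) (auto simp: algebra_simps intro: DERIV_cong[OF DERIV_mult])
  qed
  moreover have "exp (- of_real c * w) * (L' * (- \<i>)) + (exp (- of_real c * w) * (- of_real c)) * L (- \<i> * w)
      = - (LINT t|lborel. Complex c t * k t * exp (- Complex c t * w))"
  proof -
    have int2: "integrable lborel (\<lambda>t. of_real t * k t * exp (- \<i> * w * of_real t))"
    proof (rule integrable_exp_decay)
      define \<delta> where "\<delta> = (B - \<bar>Im w\<bar>) / 2"
      show "\<delta> > 0" using w by (simp add: \<delta>_def)
      fix t :: real
      have t: "\<bar>t\<bar> \<le> exp (\<delta> * \<bar>t\<bar>) / \<delta>"
      proof -
        have "\<delta> * \<bar>t\<bar> \<le> exp (\<delta> * \<bar>t\<bar>)"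
          using exp_ge_add_one_self[of "\<delta> * \<bar>t\<bar>"] by linarith
        thus ?thesis using \<open>\<delta> > 0\<close> by (simp add: field_simps)
      qed
      have "norm (of_real t * k t * exp (- \<i> * w * of_real t)) \<le>
          exp (\<delta> * \<bar>t\<bar>) / \<delta> * (A * exp (- B * \<bar>t\<bar>)) * exp (\<bar>Re (- \<i> * w)\<bar> * \<bar>t\<bar>)"
        unfolding norm_mult
        by (intro mult_mono bound norm_exp_mult_le order_trans[OF norm_ge_zero bound] mult_nonneg_nonneg)
           (use t \<open>\<delta> > 0\<close> in auto)
      also have "\<dots> = A / \<delta> * exp (\<delta> * \<bar>t\<bar> + - B * \<bar>t\<bar> + \<bar>Im w\<bar> * \<bar>t\<bar>)"
        unfolding exp_add by simp
      also have "\<delta> * \<bar>t\<bar> + - B * \<bar>t\<bar> + \<bar>Im w\<bar> * \<bar>t\<bar> = - \<delta> * \<bar>t\<bar>"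
        unfolding \<delta>_def by (simp add: field_simps)
      finally show "norm (of_real t * k t * exp (- \<i> * w * of_real t)) \<le> A / \<delta> * exp (- \<delta> * \<bar>t\<bar>)" .
    qed simp
    have "(LINT t|lborel. Complex c t * k t * exp (- Complex c t * w)) =
          (LINT t|lborel. exp (- of_real c * w) * of_real c * (k t * exp (- \<i> * w * of_real t)) +
             exp (- of_real c * w) * \<i> * (of_real t * k t * exp (- \<i> * w * of_real t)))"
      unfolding split by (rule Bochner_Integration.integral_cong) (simp_all add: Complex_eq algebra_simps)
    also have "\<dots> = exp (- of_real c * w) * of_real c * L (- \<i> * w) + exp (- of_real c * w) * \<i> * L'"
      unfolding L_def L'_def using int int2
      by (subst Bochner_Integration.integral_add) auto
    finally show ?thesis by simp
  qed
  ultimately show "((\<lambda>w. LINT t|lborel. k t * exp (- Complex c t * w)) has_field_derivative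
           - (LINT t|lborel. Complex c t * k t * exp (- Complex c t * w))) (at w)"
    unfolding eq by simp
  have "norm (LINT t|lborel. k t * exp (- Complex c t * w)) \<le>
      (LINT t|lborel. norm (k t * exp (- Complex c t * w)))" by (rule integral_norm_bound)
  also have "\<dots> \<le> (LINT t|lborel. A * exp (- c * Re w) * exp (- (B - \<bar>Im w\<bar>) * \<bar>t\<bar>))"
  proof (rule integral_mono)
    show "integrable lborel (\<lambda>t. A * exp (- c * Re w) * exp (- (B - \<bar>Im w\<bar>) * \<bar>t\<bar>))"
      using integrable_exp_neg_abs[of "B - \<bar>Im w\<bar>"] w by (intro integrable_mult_right) auto
    fix t :: real
    have "norm (k t * exp (- Complex c t * w)) \<le>
        (A * exp (- B * \<bar>t\<bar>)) * (exp (- c * Re w) * exp (\<bar>Re (- \<i> * w)\<bar> * \<bar>t\<bar>))"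
      unfolding norm_mult split
      by (intro mult_mono bound norm_exp_mult_le order_trans[OF norm_ge_zero bound] mult_nonneg_nonneg) auto
    also have "\<dots> = A * exp (- c * Re w) * exp (- B * \<bar>t\<bar> + \<bar>Im w\<bar> * \<bar>t\<bar>)"
      unfolding exp_add by simp
    also have "- B * \<bar>t\<bar> + \<bar>Im w\<bar> * \<bar>t\<bar> = - (B - \<bar>Im w\<bar>) * \<bar>t\<bar>"
      by (simp add: algebra_simps)
    finally show "norm (k t * exp (- Complex c t * w)) \<le> A * exp (- c * Re w) * exp (- (B - \<bar>Im w\<bar>) * \<bar>t\<bar>)" .
  qed (use int' in auto)
  finally show "norm (LINT t|lborel. k t * exp (- Complex c t * w)) \<le>
           A * (LINT t|lborel. exp (- (B - \<bar>Im w\<bar>) * \<bar>t\<bar>)) * exp (- c * Re w)"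
    by (simp add: mult_ac)
qed

text \<open>
  The zeros of \<open>sin (\<pi>s/a)\<close> next to the line \<open>Re s = c\<close> are \<open>0\<close> and \<open>a\<close>.
\<close>
lemma norm_inverse_sin_line_le:
  assumes "0 < c" "c < a"
  shows "norm (1 / sin (of_real (pi / a) * Complex c t)) \<le> 2 / sin (pi / a * c) * exp (- (pi / a) * \<bar>t\<bar>)"
    and "sin (of_real (pi / a) * Complex c t) \<noteq> 0" and "0 < sin (pi / a * c)"
proof -
  have "pi / a * c < pi" "0 < pi / a * c" using assms by (auto simp: field_simps)
  thus 1: "0 < sin (pi / a * c)" by (intro sin_gt_zero)
  have 2: "Re (of_real (pi / a) * Complex c t) = pi / a * c" "\<bar>Im (of_real (pi / a) * Complex c t)\<bar> = pi / a * \<bar>t\<bar>"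
    using assms by (auto simp: abs_mult)
  show "norm (1 / sin (of_real (pi / a) * Complex c t)) \<le> 2 / sin (pi / a * c) * exp (- (pi / a) * \<bar>t\<bar>)"
    "sin (of_real (pi / a) * Complex c t) \<noteq> 0"
    using norm_inverse_sin_le[of "of_real (pi / a) * Complex c t"] 1 unfolding 2 by auto
qed

text \<open>
  The two periods \<open>a\<close> and \<open>b\<close> are kept symmetric, although only \<open>a = 1\<close> and \<open>b = \<alpha>\<close> matter in the end,
  so that one shift formula covers both difference equations. The abscissa \<open>min a b / 2\<close> lies to the
  right of the pole at \<open>0\<close> and to the left of the first poles at \<open>a\<close> and \<open>b\<close>.
\<close>
definition sin_kernel :: "real \<Rightarrow> real \<Rightarrow> real \<Rightarrow> complex" where
  "sin_kernel a b t = (let s = Complex (min a b / 2) t in 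
     1 / (sin (of_real (pi / a) * s) * sin (of_real (pi / b) * s)))"

definition log_dsine :: "real \<Rightarrow> real \<Rightarrow> complex \<Rightarrow> complex" where
  "log_dsine a b w = - of_real (pi / 2) * (LINT t|lborel.
     sin_kernel a b t / Complex (min a b / 2) t * exp (- Complex (min a b / 2) t * w))"

text \<open>
  Differentiation under the integral sign cancels the denominator \<open>s\<close>, so this is the derivative of
  \<open>log_dsine\<close>.
\<close>
definition log_dsine' :: "real \<Rightarrow> real \<Rightarrow> complex \<Rightarrow> complex" where
  "log_dsine' a b w = of_real (pi / 2) * (LINT t|lborel.
     sin_kernel a b t * exp (- Complex (min a b / 2) t * w))"

lemma log_dsine_commute: "log_dsine a b = log_dsine b a"
proof -
  have "sin_kernel a b = sin_kernel b a"
    unfolding sin_kernel_def min.commute[of b a] by (rule ext) (simp only: Let_def mult.commute)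
  thus ?thesis unfolding log_dsine_def min.commute[of b a] by simp
qed

lemma measurable_sin_line [measurable]:
  "(\<lambda>t. sin (of_real a * Complex c t)) \<in> borel_measurable borel"
  "(\<lambda>t. Complex c t) \<in> borel_measurable borel"
  by (intro borel_measurable_continuous_onI continuous_intros; simp add: Complex_eq; intro continuous_intros)+

lemma measurable_sin_kernel [measurable]: "sin_kernel a b \<in> borel_measurable borel"
  unfolding sin_kernel_def Let_def by measurable

text \<open>
  The decay rates \<open>\<pi>/a\<close> and \<open>\<pi>/b\<close> of the two factors add up. The resulting strip is wider than
  \<open>\<bar>Im w\<bar> < \<pi>/a\<close>, which is what makes room for the shifts below.
\<close>
lemma sin_kernel_bound:
  assumes ab: "a > 0" "b > 0"
  obtains A where "\<And>t. norm (sin_kernel a b t) \<le> A * exp (- (pi / a + pi / b) * \<bar>t\<bar>)"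
    and "\<And>t. norm (sin_kernel a b t / Complex (min a b / 2) t) \<le> A / (min a b / 2) * exp (- (pi / a + pi / b) * \<bar>t\<bar>)"
proof -
  define c where "c = min a b / 2"
  have c: "0 < c" "c < a" "c < b" using ab by (auto simp: c_def)
  define A where "A = 2 / sin (pi / a * c) * (2 / sin (pi / b * c))"
  have A: "A > 0" using norm_inverse_sin_line_le(3)[of c] c by (simp add: A_def)
  have 1: "norm (sin_kernel a b t) \<le> A * exp (- (pi / a + pi / b) * \<bar>t\<bar>)" for t
  proof -
    have "norm (sin_kernel a b t) = norm (1 / sin (of_real (pi / a) * Complex c t)) * norm (1 / sin (of_real (pi / b) * Complex c t))"
      by (simp add: sin_kernel_def c_def norm_divide norm_mult Let_def)
    also have "\<dots> \<le> (2 / sin (pi / a * c) * exp (- (pi / a) * \<bar>t\<bar>)) * (2 / sin (pi / b * c) * exp (- (pi / b) * \<bar>t\<bar>))"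
      by (intro mult_mono norm_inverse_sin_line_le(1) norm_ge_zero order_trans[OF norm_ge_zero norm_inverse_sin_line_le(1)] c)
    also have "\<dots> = A * exp (- (pi / a) * \<bar>t\<bar> + - (pi / b) * \<bar>t\<bar>)"
      unfolding A_def exp_add by simp
    finally show ?thesis by (simp add: algebra_simps)
  qed
  have "norm (sin_kernel a b t / Complex c t) \<le> A / c * exp (- (pi / a + pi / b) * \<bar>t\<bar>)" for t
  proof -
    have "c \<le> norm (Complex c t)" using complex_Re_le_cmod[of "Complex c t"] by simp
    hence "norm (sin_kernel a b t) / norm (Complex c t) \<le> A * exp (- (pi / a + pi / b) * \<bar>t\<bar>) / c"
      using 1[of t] c A by (intro frac_le) auto
    thus ?thesis by (simp add: norm_divide)
  qed
  with 1 that show ?thesis unfolding c_def by blast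
qed

lemma has_field_derivative_log_dsine:
  assumes ab: "a > 0" "b > 0" and w: "\<bar>Im w\<bar> < pi / a + pi / b"
  shows "(log_dsine a b has_field_derivative log_dsine' a b w) (at w)"
proof -
  obtain A where A: "\<And>t. norm (sin_kernel a b t / Complex (min a b / 2) t) \<le> A / (min a b / 2) * exp (- (pi / a + pi / b) * \<bar>t\<bar>)"
    by (rule sin_kernel_bound[OF ab]) blast
  have nz: "Complex (min a b / 2) t \<noteq> 0" for t using ab by (auto simp: complex_eq_iff)
  have "((\<lambda>w. LINT t|lborel. sin_kernel a b t / Complex (min a b / 2) t * exp (- Complex (min a b / 2) t * w)) has_field_derivative
      - (LINT t|lborel. Complex (min a b / 2) t * (sin_kernel a b t / Complex (min a b / 2) t) * exp (- Complex (min a b / 2) t * w))) (at w)"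
    by (rule has_field_derivative_vertical_integral(1)[OF _ A w]) measurable
  also have "(\<lambda>t. Complex (min a b / 2) t * (sin_kernel a b t / Complex (min a b / 2) t)) = sin_kernel a b"
    using nz by (simp add: fun_eq_iff)
  finally show ?thesis
    unfolding log_dsine_def[abs_def] log_dsine'_def
    by (auto intro!: derivative_eq_intros)
qed

lemma holomorphic_log_dsine:
  assumes ab: "a > 0" "b > 0"
  shows "log_dsine a b holomorphic_on {w. \<bar>Im w\<bar> < pi / a + pi / b}"
  using has_field_derivative_log_dsine[OF ab]
  by (auto simp: holomorphic_on_def field_differentiable_def intro: has_field_derivative_at_within)

lemma log_dsine_decay:
  assumes ab: "a > 0" "b > 0" and y: "\<bar>y\<bar> < pi / a + pi / b"
  obtains C where "\<And>x. norm (log_dsine a b (Complex x y)) \<le> C * exp (- (min a b / 2) * x)"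
    and "\<And>x. norm (log_dsine' a b (Complex x y)) \<le> C * exp (- (min a b / 2) * x)"
proof -
  obtain A where A: "\<And>t. norm (sin_kernel a b t) \<le> A * exp (- (pi / a + pi / b) * \<bar>t\<bar>)"
    "\<And>t. norm (sin_kernel a b t / Complex (min a b / 2) t) \<le> A / (min a b / 2) * exp (- (pi / a + pi / b) * \<bar>t\<bar>)"
    by (rule sin_kernel_bound[OF ab]) blast
  define J where "J = (LINT t|lborel. exp (- (pi / a + pi / b - \<bar>y\<bar>) * \<bar>t\<bar>))"
  define C1 where "C1 = pi / 2 * (A / (min a b / 2) * J)"
  define C2 where "C2 = pi / 2 * (A * J)"
  have 1: "norm (log_dsine a b (Complex x y)) \<le> C1 * exp (- (min a b / 2) * x)" for x
  proof -
    have "norm (LINT t|lborel. sin_kernel a b t / Complex (min a b / 2) t * exp (- Complex (min a b / 2) t * Complex x y))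
        \<le> A / (min a b / 2) * J * exp (- (min a b / 2) * x)"
      using has_field_derivative_vertical_integral(3)[OF _ A(2), of "Complex x y" "min a b / 2"] y
      by (simp add: J_def)
    from mult_left_mono[OF this, of "pi / 2"] show ?thesis
      unfolding log_dsine_def C1_def norm_mult by (simp add: mult.assoc)
  qed
  have 2: "norm (log_dsine' a b (Complex x y)) \<le> C2 * exp (- (min a b / 2) * x)" for x
  proof -
    have "norm (LINT t|lborel. sin_kernel a b t * exp (- Complex (min a b / 2) t * Complex x y))
        \<le> A * J * exp (- (min a b / 2) * x)"
      using has_field_derivative_vertical_integral(3)[OF _ A(1), of "Complex x y" "min a b / 2"] y
      by (simp add: J_def)
    from mult_left_mono[OF this, of "pi / 2"] show ?thesis
      unfolding log_dsine'_def C2_def norm_mult by (simp add: mult.assoc)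
  qed
  show ?thesis
  proof (rule that[of "max C1 C2"])
    fix x
    show "norm (log_dsine a b (Complex x y)) \<le> max C1 C2 * exp (- (min a b / 2) * x)"
      by (rule order_trans[OF 1]) (auto intro: mult_right_mono)
    show "norm (log_dsine' a b (Complex x y)) \<le> max C1 C2 * exp (- (min a b / 2) * x)"
      by (rule order_trans[OF 2]) (auto intro: mult_right_mono)
  qed
qed

lemma log_dsine_tendsto_0:
  assumes ab: "a > 0" "b > 0" and y: "\<bar>y\<bar> < pi / a + pi / b"
  shows "((\<lambda>x. log_dsine a b (Complex x y)) \<longlongrightarrow> 0) at_top"
proof -
  obtain C where C: "\<And>x. norm (log_dsine a b (Complex x y)) \<le> C * exp (- (min a b / 2) * x)"
    by (rule log_dsine_decay[OF ab y]) blast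
  have "((\<lambda>x. exp (- (min a b / 2 * x))) \<longlongrightarrow> 0) at_top"
    by (intro filterlim_compose[OF exp_at_bot] filterlim_compose[OF filterlim_uminus_at_bot_at_top]
          filterlim_tendsto_pos_mult_at_top[OF tendsto_const _ filterlim_ident]) (use ab in auto)
  from tendsto_mult_right_zero[OF this, of C] show ?thesis
    by (rule Lim_null_comparison[rotated]) (use C in auto)
qed

section \<open>The two difference equations\<close>

lemma strip_eq_0_if_deriv_0:
  fixes P :: "complex \<Rightarrow> complex"
  assumes deriv: "\<And>w. \<bar>Im w\<bar> < r \<Longrightarrow> (P has_field_derivative 0) (at w)"
    and lim: "((\<lambda>x. P (of_real x)) \<longlongrightarrow> 0) at_top" and w: "\<bar>Im w\<bar> < r"
  shows "P w = 0"
proof -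
  define S where "S = {w. \<bar>Im w\<bar> < r}"
  have S: "S = {s. Im s < r} \<inter> {s. Im s > -r}" by (auto simp: S_def)
  have "convex S" unfolding S
    by (intro convex_Int convex_halfspace_Im_lt convex_halfspace_Im_gt)
  then obtain C where C: "\<And>w. w \<in> S \<Longrightarrow> P w = C"
    using has_field_derivative_zero_constant[of S P] deriv
    by (auto simp: S_def intro: has_field_derivative_at_within)
  have "r > 0" using w by linarith
  hence "P (of_real x) = C" for x by (intro C) (auto simp: S_def)
  with lim have "((\<lambda>x::real. C) \<longlongrightarrow> 0) at_top" by simp
  hence "C = 0" by (simp add: tendsto_const_iff)
  thus ?thesis using C[of w] w by (simp add: S_def)
qed

lemma one_plus_exp_notin_nonpos_Reals:
  fixes v :: complex
  assumes "\<bar>Im v\<bar> < pi"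
  shows "1 + exp v \<notin> \<real>\<^sub>\<le>\<^sub>0" "1 + exp v \<noteq> 0"
proof -
  show "1 + exp v \<notin> \<real>\<^sub>\<le>\<^sub>0"
  proof
    assume "1 + exp v \<in> \<real>\<^sub>\<le>\<^sub>0"
    then obtain r where r: "1 + exp v = of_real r" "r \<le> 0" by (auto elim!: nonpos_Reals_cases)
    hence e: "exp v = of_real (r - 1)" by (simp add: algebra_simps)
    have "Ln (exp v) = v" using assms by (intro Ln_exp) auto
    moreover have "Im (Ln (exp v)) = pi"
      unfolding e using r by (subst Ln_of_real') (auto)
    ultimately show False using assms by auto
  qed
  thus "1 + exp v \<noteq> 0" by auto
qed

text \<open>
  The difference of the shifted exponentials is \<open>-2\<i> sin (\<pi>s/a) e^{-sw}\<close>. It cancels one factor of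
  the kernel, and after rescaling \<open>t\<close> by \<open>b\<close> the remaining integral is elementary.
\<close>
lemma log_dsine'_shift:
  assumes ab: "a > 0" "b > 0" and w: "\<bar>Im w\<bar> < pi / b"
  shows "log_dsine' a b (w + \<i> * of_real (pi / a)) - log_dsine' a b (w - \<i> * of_real (pi / a))
           = - (2 * of_real pi * \<i> * of_real b / (1 + exp (of_real b * w)))"
proof -
  define c where "c = min a b / 2"
  have c: "0 < c" "c < a" "c < b" "c \<le> b / 2" using ab by (auto simp: c_def)
  let ?\<delta> = "\<i> * complex_of_real (pi / a)"
  obtain A where A: "\<And>t. norm (sin_kernel a b t) \<le> A * exp (- (pi / a + pi / b) * \<bar>t\<bar>)"
    by (rule sin_kernel_bound[OF ab]) blast
  have int: "integrable lborel (\<lambda>t. sin_kernel a b t * exp (- Complex c t * v))" if "\<bar>Im v\<bar> < pi / a + pi / b" for v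
    by (rule has_field_derivative_vertical_integral(2)[OF measurable_sin_kernel A that])
  have pa: "0 < pi / a" using ab by simp
  have im: "\<bar>Im (w + ?\<delta>)\<bar> < pi / a + pi / b" "\<bar>Im (w - ?\<delta>)\<bar> < pi / a + pi / b"
    using w pa by (auto simp: abs_if split: if_splits)
  have kern: "sin_kernel a b t * exp (- Complex c t * (w + ?\<delta>)) - sin_kernel a b t * exp (- Complex c t * (w - ?\<delta>))
      = - 2 * \<i> * (exp (- Complex c t * w) / sin (of_real (pi / b) * Complex c t))" for t
  proof -
    define x where "x = of_real (pi / a) * Complex c t"
    have nz: "sin x \<noteq> 0" unfolding x_def by (rule norm_inverse_sin_line_le(2)) (use c in auto)
    have e: "exp (- Complex c t * (w + ?\<delta>)) = exp (- Complex c t * w) * exp (- (\<i> * x))"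
            "exp (- Complex c t * (w - ?\<delta>)) = exp (- Complex c t * w) * exp (\<i> * x)"
      by (simp_all add: x_def algebra_simps flip: exp_add)
    have s: "exp (- (\<i> * x)) - exp (\<i> * x) = - 2 * \<i> * sin x"
      by (simp add: sin_exp_eq)
    have k: "sin_kernel a b t = 1 / (sin x * sin (of_real (pi / b) * Complex c t))"
      by (simp add: sin_kernel_def x_def c_def Let_def)
    have "sin_kernel a b t * exp (- Complex c t * (w + ?\<delta>)) - sin_kernel a b t * exp (- Complex c t * (w - ?\<delta>))
        = sin_kernel a b t * exp (- Complex c t * w) * (exp (- (\<i> * x)) - exp (\<i> * x))"
      unfolding e by (simp add: algebra_simps)
    also have "\<dots> = - 2 * \<i> * (exp (- Complex c t * w) / sin (of_real (pi / b) * Complex c t))"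
      unfolding s k using nz by simp
    finally show ?thesis .
  qed
  have "log_dsine' a b (w + ?\<delta>) - log_dsine' a b (w - ?\<delta>) =
      of_real (pi / 2) * (LINT t|lborel. sin_kernel a b t * exp (- Complex c t * (w + ?\<delta>)) - sin_kernel a b t * exp (- Complex c t * (w - ?\<delta>)))"
    unfolding log_dsine'_def c_def[symmetric] Bochner_Integration.integral_diff[OF int[OF im(1)] int[OF im(2)]]
    by (simp add: right_diff_distrib)
  also have "\<dots> = of_real (pi / 2) * (- 2 * \<i>) * (LINT t|lborel. exp (- Complex c t * w) / sin (of_real (pi / b) * Complex c t))"
    unfolding kern integral_mult_right_zero by simp
  also have "(LINT t|lborel. exp (- Complex c t * w) / sin (of_real (pi / b) * Complex c t)) =
      b *\<^sub>R (LINT t|lborel. exp (- Complex c (0 + b * t) * w) / sin (of_real (pi / b) * Complex c (0 + b * t)))"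
    using ab by (subst lborel_integral_real_affine[where c = b and t = 0]) auto
  also have "(\<lambda>t. exp (- Complex c (0 + b * t) * w) / sin (of_real (pi / b) * Complex c (0 + b * t))) =
      (\<lambda>t. exp (- Complex (c / b) t * (of_real b * w)) / sin (of_real pi * Complex (c / b) t))"
  proof
    fix t
    have 1: "Complex c (0 + b * t) = of_real b * Complex (c / b) t" using ab by (simp add: complex_eq_iff)
    show "exp (- Complex c (0 + b * t) * w) / sin (of_real (pi / b) * Complex c (0 + b * t)) =
      exp (- Complex (c / b) t * (of_real b * w)) / sin (of_real pi * Complex (c / b) t)"
      unfolding 1 using ab by (simp add: mult_ac)
  qed
  also have "(LINT t|lborel. exp (- Complex (c / b) t * (of_real b * w)) / sin (of_real pi * Complex (c / b) t)) = 2 / (1 + exp (of_real b * w))"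
    by (rule integral_exp_over_sin) (use w c ab in \<open>auto simp: abs_mult field_simps\<close>)
  finally show ?thesis by (simp add: scaleR_conv_of_real)
qed

lemma has_field_derivative_at_shift:
  assumes "(f has_field_derivative D) (at (w + d))"
  shows "((\<lambda>w. f (w + d)) has_field_derivative D) (at w)"
  using assms by (simp add: DERIV_shift)

text \<open>
  Both sides have the same derivative and vanish as \<open>Re w \<rightarrow> \<infinity>\<close>. On this strip \<open>e^{-bw}\<close> avoids the
  negative axis, so the principal logarithm is holomorphic.
\<close>
lemma log_dsine_shift:
  assumes ab: "a > 0" "b > 0" and w: "\<bar>Im w\<bar> < pi / b"
  shows "log_dsine a b (w + \<i> * of_real (pi / a)) - log_dsine a b (w - \<i> * of_real (pi / a))
           = 2 * of_real pi * \<i> * Ln (1 + exp (- of_real b * w))"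
proof -
  let ?\<delta> = "\<i> * complex_of_real (pi / a)"
  define P where "P = (\<lambda>w. log_dsine a b (w + ?\<delta>) - log_dsine a b (w - ?\<delta>) - 2 * of_real pi * \<i> * Ln (1 + exp (- of_real b * w)))"
  have pa: "0 < pi / a" "0 < pi / b" using ab by simp_all
  have "P w = 0"
  proof (rule strip_eq_0_if_deriv_0[OF _ _ w])
    fix w :: complex assume w: "\<bar>Im w\<bar> < pi / b"
    have im: "\<bar>Im (w + ?\<delta>)\<bar> < pi / a + pi / b" "\<bar>Im (w - ?\<delta>)\<bar> < pi / a + pi / b"
      using w pa by (auto simp: abs_if split: if_splits)
    have bw: "\<bar>Im (- of_real b * w)\<bar> < pi" "\<bar>Im (of_real b * w)\<bar> < pi"
      using w ab by (auto simp: abs_mult field_simps)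
    note nz = one_plus_exp_notin_nonpos_Reals[OF bw(1)] one_plus_exp_notin_nonpos_Reals[OF bw(2)]
    have d1: "((\<lambda>w. log_dsine a b (w + ?\<delta>)) has_field_derivative log_dsine' a b (w + ?\<delta>)) (at w)"
      by (rule has_field_derivative_at_shift[OF has_field_derivative_log_dsine[OF ab im(1)]])
    have d2: "((\<lambda>w. log_dsine a b (w - ?\<delta>)) has_field_derivative log_dsine' a b (w - ?\<delta>)) (at w)"
      using has_field_derivative_at_shift[where d = "- ?\<delta>"] has_field_derivative_log_dsine[OF ab im(2)] by simp
    have d3: "((\<lambda>w. Ln (1 + exp (- of_real b * w))) has_field_derivative
        (exp (- of_real b * w) * (- of_real b) / (1 + exp (- of_real b * w)))) (at w)"
      using nz(1) by (auto intro!: derivative_eq_intros simp: divide_inverse mult_ac)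
    have e: "exp (- of_real b * w) * (- of_real b) / (1 + exp (- of_real b * w)) = - of_real b / (1 + exp (of_real b * w))"
    proof -
      have "exp (- of_real b * w) * exp (of_real b * w) = 1" by (simp flip: exp_add)
      thus ?thesis using nz(2,4) by (simp add: divide_simps) (simp add: algebra_simps)
    qed
    have "(P has_field_derivative (log_dsine' a b (w + ?\<delta>) - log_dsine' a b (w - ?\<delta>) - 2 * of_real pi * \<i> * (- of_real b / (1 + exp (of_real b * w))))) (at w)"
      unfolding P_def using DERIV_diff[OF DERIV_diff[OF d1 d2] DERIV_cmult[OF d3[unfolded e], of "2 * of_real pi * \<i>"]] .
    thus "(P has_field_derivative 0) (at w)"
      unfolding log_dsine'_shift[OF ab w] by simp
  next
    have "((\<lambda>x. log_dsine a b (Complex x (pi / a)) - log_dsine a b (Complex x (- (pi / a))) - 2 * of_real pi * \<i> * Ln (1 + of_real (exp (- (b * x))))) 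
        \<longlongrightarrow> 0 - 0 - 2 * of_real pi * \<i> * Ln (1 + of_real 0)) at_top"
    proof (intro tendsto_intros log_dsine_tendsto_0[OF ab])
      show "((\<lambda>x. exp (- (b * x))) \<longlongrightarrow> 0) at_top"
        by (intro filterlim_compose[OF exp_at_bot] filterlim_compose[OF filterlim_uminus_at_bot_at_top]
          filterlim_tendsto_pos_mult_at_top[OF tendsto_const _ filterlim_ident]) (use ab in auto)
    qed (use pa in auto)
    moreover have "P (of_real x) = log_dsine a b (Complex x (pi / a)) - log_dsine a b (Complex x (- (pi / a))) - 2 * of_real pi * \<i> * Ln (1 + of_real (exp (- (b * x))))" for x
      using exp_of_real[of "- (b * x)", where 'a = complex] by (simp add: P_def Complex_eq)
    ultimately show "((\<lambda>x. P (of_real x)) \<longlongrightarrow> 0) at_top" by simp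
  qed
  thus ?thesis by (simp add: P_def)
qed

section \<open>The function F as a double sine integral\<close>

lemma integral_exp_over_one_plus_exp:
  assumes s: "0 < Re s" "Re s < 1"
  shows "(LINT x|lborel. exp (s * of_real x) / (1 + exp (of_real x))) = of_real pi / sin (of_real pi * s)"
proof -
  have "\<bar>Re (s - 1/2)\<bar> < 1 / 2" using s by (auto simp: abs_if)
  from integral_exp_sech_half[OF this] show ?thesis
    unfolding exp_mult_sech_half by (simp add: sin_cos_eq right_diff_distrib) (metis cos_minus minus_diff_eq)
qed

text \<open>
  Replace \<open>1 / (1 + e^{w - x/\<alpha>})\<close> by its Mellin integral over the line \<open>Re s = c\<close>. The integral over
  \<open>x\<close> can then be carried out first and produces the second sine. The exchange is legitimate because
  the absolute value of the integrand is the product of a function of \<open>t\<close> and a function of \<open>x\<close>.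
\<close>
lemma F_int_eq_log_dsine':
  assumes \<alpha>: "\<alpha> > 0" and w: "\<bar>Im w\<bar> < pi"
  shows "F_int \<alpha> w = log_dsine' 1 \<alpha> w"
proof -
  define c where "c = min 1 \<alpha> / 2"
  have c: "0 < c" "c < 1" "c < \<alpha>" "c \<le> 1 / 2" using \<alpha> by (auto simp: c_def)
  define p where "p = (\<lambda>t. exp (- Complex c t * w) / sin (of_real pi * Complex c t))"
  define q where "q = (\<lambda>x t. exp (Complex c t / of_real \<alpha> * of_real x) / (1 + exp (complex_of_real x)))"
  have [measurable]: "p \<in> borel_measurable borel"
    using measurable_sin_line(1)[of pi c] unfolding p_def by measurable
  have [measurable]: "case_prod q \<in> borel_measurable (borel \<Otimes>\<^sub>M borel)"
    unfolding q_def case_prod_beta Complex_eq by measurable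
  have int_p: "integrable lborel p"
  proof -
    have "integrable lborel (\<lambda>t. 1 / sin (of_real pi * Complex c t) * exp (- Complex c t * w))"
      using norm_inverse_sin_line_le(1)[of c 1] c
      by (intro has_field_derivative_vertical_integral(2)[where B = pi and A = "2 / sin (pi * c)", OF _ _ w]) auto
    thus ?thesis by (simp add: p_def)
  qed
  have q_norm: "norm (q x t) = norm (q x 0)" for x t
    by (simp add: q_def norm_divide)
  have int_q: "integrable lborel (\<lambda>x. q x t)" for t
  proof -
    have "integrable lborel (\<lambda>x. complex_of_real (sech_half x) * exp ((Complex c t / of_real \<alpha> - 1/2) * of_real x))"
    proof (rule integrable_bilateral_Laplace[where A = 1 and B = "1/2"])
      show "\<bar>Re (Complex c t / of_real \<alpha> - 1/2)\<bar> < 1 / 2" using c \<alpha> by (auto simp: abs_if field_simps)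
    qed (use sech_half_bound in \<open>auto simp: less_imp_le\<close>)
    thus ?thesis
      using exp_mult_sech_half[of "Complex c t / of_real \<alpha> - 1/2"] by (simp add: q_def mult.commute)
  qed
  have swap: "(LINT x|lborel. LINT t|lborel. p t * q x t) = (LINT t|lborel. LINT x|lborel. p t * q x t)"
  proof (rule lborel_pair.Fubini_integral)
    show "integrable (lborel \<Otimes>\<^sub>M lborel) (\<lambda>(t, x). p t * q x t)"
    proof (rule lborel_pair.Fubini_integrable)
      show "integrable lborel (\<lambda>t. LINT x|lborel. norm (case (t, x) of (t, x) \<Rightarrow> p t * q x t))"
      proof -
        have "norm (p t * q x t) = norm (p t) * norm (q x 0)" for x t
          using q_norm[of x t] by (simp only: norm_mult)
        thus ?thesis using int_p by simp
      qed
      show "AE t in lborel. integrable lborel (\<lambda>x. case (t, x) of (t, x) \<Rightarrow> p t * q x t)"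
        using int_q by simp
    qed measurable
  qed
  have inner_t: "(LINT t|lborel. p t * q x t) = 2 * (1 / ((1 + exp (w - of_real (x / \<alpha>))) * (1 + exp (of_real x))))" for x
  proof -
    have "p t * q x t = exp (- Complex c t * (w - of_real (x / \<alpha>))) / sin (of_real pi * Complex c t) / (1 + exp (of_real x))" for t
      by (simp add: p_def q_def field_simps flip: exp_add)
    hence "(LINT t|lborel. p t * q x t) = (LINT t|lborel. exp (- Complex c t * (w - of_real (x / \<alpha>))) / sin (of_real pi * Complex c t)) / (1 + exp (of_real x))"
      by (simp only: integral_divide_zero)
    also have "(LINT t|lborel. exp (- Complex c t * (w - of_real (x / \<alpha>))) / sin (of_real pi * Complex c t)) = 2 / (1 + exp (w - of_real (x / \<alpha>)))"
      by (rule integral_exp_over_sin) (use w c in auto)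
    finally show ?thesis by simp
  qed
  have inner_x: "(LINT x|lborel. p t * q x t) = of_real pi * (sin_kernel 1 \<alpha> t * exp (- Complex c t * w))" for t
  proof -
    have "(LINT x|lborel. p t * q x t) = p t * (LINT x|lborel. q x t)" by simp
    also have "(LINT x|lborel. q x t) = of_real pi / sin (of_real pi * (Complex c t / of_real \<alpha>))"
      unfolding q_def by (rule integral_exp_over_one_plus_exp) (use c \<alpha> in auto)
    finally show ?thesis by (simp add: p_def sin_kernel_def Let_def c_def mult_ac)
  qed
  have "2 * F_int \<alpha> w = (LINT x|lborel. LINT t|lborel. p t * q x t)"
    unfolding F_int_def inner_t by (rule integral_mult_right_zero[symmetric])
  also have "\<dots> = of_real pi * (LINT t|lborel. sin_kernel 1 \<alpha> t * exp (- Complex c t * w))"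
    unfolding swap inner_x by (rule integral_mult_right_zero)
  finally show ?thesis by (simp add: log_dsine'_def c_def field_simps)
qed

section \<open>Functions with two incommensurable periods on a bounded interval\<close>

lemma irrational_orbit_not_Ints:
  fixes \<theta> :: real
  assumes "\<theta> \<notin> \<rat>"
  shows "of_nat n * \<theta> + 1 / 2 \<notin> \<int>"
proof
  assume "of_nat n * \<theta> + 1 / 2 \<in> \<int>"
  then obtain m :: int where m: "of_nat n * \<theta> + 1 / 2 = of_int m" by (auto elim: Ints_cases)
  show False
  proof (cases "n = 0")
    case True
    hence "of_int (2 * m) = (1::real)" using m by simp
    hence "2 * m = 1" by linarith
    thus False by presburger
  next
    case False
    hence "\<theta> = (of_int m - 1 / 2) / of_nat n" using m by (simp add: field_simps)
    also have "\<dots> \<in> \<rat>" by simp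
    finally show False using assms by simp
  qed
qed

text \<open>
  The periods are \<open>2p\<close> and \<open>2q\<close> and the interval has length \<open>2(p + q)\<close>. From every point of the
  interval except \<open>q - p\<close> exactly one of the moves \<open>y \<mapsto> y + 2p\<close> and \<open>y \<mapsto> y - 2q\<close> stays inside; modulo
  \<open>2(p + q)\<close> they are the same move. The orbit of \<open>0\<close> is thus an orbit of the rotation by the
  irrational angle \<open>p / (p + q)\<close> (in full turns), hence dense by Kronecker's theorem, and it never meets
  \<open>q - p\<close>, whose image would be an endpoint. A continuous function that is constant along it is constant.
\<close>
lemma two_periods_imp_constant:
  fixes d :: "real \<Rightarrow> 'a::metric_space" and p q :: real
  assumes p: "p > 0" and q: "q > 0" and irr: "p / q \<notin> \<rat>"
    and cont: "continuous_on {-(p+q)<..<p+q} d"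
    and per_p: "\<And>y. \<bar>y\<bar> < q \<Longrightarrow> d (y + p) = d (y - p)"
    and per_q: "\<And>y. \<bar>y\<bar> < p \<Longrightarrow> d (y + q) = d (y - q)"
    and y: "\<bar>y\<bar> < p + q"
  shows "d y = d 0"
proof -
  define \<theta> where "\<theta> = p / (p + q)"
  define L where "L = 2 * (p + q)"
  have L: "L > 0" "\<theta> * L = 2 * p" using p q by (auto simp: L_def \<theta>_def field_simps)
  have \<theta>: "0 < \<theta>" "\<theta> < 1" using p q by (auto simp: \<theta>_def)
  have irr\<theta>: "\<theta> \<notin> \<rat>"
  proof
    assume "\<theta> \<in> \<rat>"
    hence "\<theta> / (1 - \<theta>) \<in> \<rat>" by simp
    also have "1 - \<theta> = q / (p + q)" using p q by (simp add: \<theta>_def field_simps)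
    hence "\<theta> / (1 - \<theta>) = p / q" using p q by (simp add: \<theta>_def)
    finally show False using irr by simp
  qed
  note notint = irrational_orbit_not_Ints[OF irr\<theta>]
  \<comment> \<open>The orbit of \<open>0\<close>: the offset \<open>1/2\<close> centres the interval, so that the excluded value
    \<open>frac = 0\<close> is the left endpoint.\<close>
  define orb where "orb = (\<lambda>n. L * (frac (of_nat n * \<theta> + 1 / 2) - 1 / 2))"
  have orbit: "d (orb n) = d 0" for n
  proof (induction n)
    case 0
    have "frac (1 / 2 :: real) = 1 / 2" by (simp add: frac_eq)
    thus ?case by (simp add: orb_def)
  next
    case (Suc n)
    define f where "f = frac (of_nat n * \<theta> + 1 / 2)"
    have f: "0 < f" "f < 1" using notint[of n] by (auto simp: f_def frac_gt_0_iff frac_lt_1)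
    have Suc_eq: "frac (of_nat (Suc n) * \<theta> + 1 / 2) = frac (f + \<theta>)"
      using frac_in_Ints_iff by (simp add: f_def frac_def algebra_simps)
    have ne1: "f + \<theta> \<noteq> 1"
    proof
      assume "f + \<theta> = 1"
      hence "frac (of_nat (Suc n) * \<theta> + 1 / 2) = 0" unfolding Suc_eq by simp
      thus False using notint[of "Suc n"] by (simp add: frac_eq_0_iff)
    qed
    have on: "orb n = L * f - (p + q)" by (simp add: orb_def f_def L_def algebra_simps)
    have b: "- (p + q) < orb n" "orb n < p + q"
      using mult_pos_pos[OF L(1) f(1)] mult_strict_left_mono[OF f(2) L(1)] unfolding on L_def by auto
    show ?case
    proof (cases "f + \<theta> < 1")
      case True
      hence "frac (f + \<theta>) = f + \<theta>" using f \<theta> by (simp add: frac_eq)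
      hence eq: "orb (Suc n) = orb n + 2 * p"
        using L(2) unfolding orb_def Suc_eq by (simp add: f_def algebra_simps)
      have "L * (f + \<theta>) < L" using True L(1) by simp
      hence "orb n + 2 * p < p + q"
        using L(2) unfolding on by (simp add: L_def algebra_simps)
      hence "d ((orb n + p) + p) = d ((orb n + p) - p)" using b by (intro per_p) auto
      thus ?thesis using Suc.IH by (simp add: eq algebra_simps)
    next
      case False
      hence "1 < f + \<theta>" using ne1 by simp
      have fr: "frac (f + \<theta>) = f + \<theta> - 1" using f \<theta> \<open>1 < f + \<theta>\<close> by (simp add: frac_unique_iff)
      have "orb (Suc n) = L * f + \<theta> * L - L - L / 2"
        unfolding orb_def Suc_eq fr by (simp add: algebra_simps)
      hence eq: "orb (Suc n) = orb n - 2 * q"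
        unfolding on L(2) by (simp add: L_def field_simps)
      have "L < L * (f + \<theta>)" using \<open>1 < f + \<theta>\<close> L(1) by simp
      hence "- (p + q) < orb n - 2 * q"
        using L(2) unfolding on by (simp add: L_def algebra_simps)
      hence "d ((orb n - q) + q) = d ((orb n - q) - q)" using b by (intro per_q) auto
      thus ?thesis using Suc.IH by (simp add: eq)
    qed
  qed
  show ?thesis
  proof (rule ccontr)
    assume ne: "d y \<noteq> d 0"
    have "isCont d y" using cont y by (simp add: continuous_on_eq_continuous_at abs_less_iff)
    then obtain \<delta> where \<delta>: "\<delta> > 0" "\<And>x. dist x y < \<delta> \<Longrightarrow> dist (d x) (d y) < dist (d y) (d 0)"
      using ne unfolding continuous_at_eps_delta by (metis zero_less_dist_iff)
    define \<epsilon> where "\<epsilon> = min (\<delta> / L) (min (1/2 - y / L) (1/2 + y / L))"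
    have yL: "- (1/2) < y / L" "y / L < 1/2" using y p q by (auto simp: L_def field_simps abs_less_iff)
    have "\<epsilon> > 0" using \<delta> L yL by (auto simp: \<epsilon>_def)
    obtain h k where hk: "k > 0" "\<bar>of_int k * \<theta> - of_int h - y / L\<bar> < \<epsilon>"
      by (rule sequence_of_fractional_parts_is_dense[OF irr\<theta> \<open>\<epsilon> > 0\<close>, where \<alpha> = "y / L"]) blast
    define \<eta> where "\<eta> = of_int k * \<theta> - of_int h - y / L"
    have \<eta>: "\<bar>\<eta>\<bar> < \<delta> / L" "\<bar>\<eta>\<bar> < 1/2 - y / L" "\<bar>\<eta>\<bar> < 1/2 + y / L"
      using hk(2) unfolding \<eta>_def[symmetric] \<epsilon>_def by simp_all
    have "frac (of_nat (nat k) * \<theta> + 1 / 2) = y / L + \<eta> + 1 / 2"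
    proof (subst frac_unique_iff, intro conjI)
      have "of_nat (nat k) * \<theta> + 1 / 2 - (y / L + \<eta> + 1 / 2) = of_int h"
        using hk(1) by (simp add: \<eta>_def)
      thus "of_nat (nat k) * \<theta> + 1 / 2 - (y / L + \<eta> + 1 / 2) \<in> \<int>" by simp
      show "0 \<le> y / L + \<eta> + 1 / 2" "y / L + \<eta> + 1 / 2 < 1" using \<eta> by linarith+
    qed
    hence "orb (nat k) = y + L * \<eta>" using L(1) by (simp add: orb_def field_simps)
    hence "dist (orb (nat k)) y < \<delta>" using \<eta>(1) L(1) by (simp add: dist_real_def abs_mult field_simps)
    from \<delta>(2)[OF this] show False unfolding orbit by (simp add: dist_commute)
  qed
qed

text \<open>
  By the preceding lemma \<open>D\<close> is constant on vertical segments, so its derivative in the direction \<open>\<i>\<close>,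
  and with it the complex derivative, vanishes.
\<close>
lemma holomorphic_two_periods_eq_0:
  fixes D :: "complex \<Rightarrow> complex"
  assumes p: "p > 0" and q: "q > 0" and irr: "p / q \<notin> \<rat>"
    and hol: "D holomorphic_on {w. 0 < Re w \<and> \<bar>Im w\<bar> < p + q}"
    and per_p: "\<And>w. 0 < Re w \<Longrightarrow> \<bar>Im w\<bar> < q \<Longrightarrow> D (w + \<i> * of_real p) = D (w - \<i> * of_real p)"
    and per_q: "\<And>w. 0 < Re w \<Longrightarrow> \<bar>Im w\<bar> < p \<Longrightarrow> D (w + \<i> * of_real q) = D (w - \<i> * of_real q)"
    and lim: "((\<lambda>x. D (of_real x)) \<longlongrightarrow> 0) at_top"
    and w: "0 < Re w" "\<bar>Im w\<bar> < p + q"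
  shows "D w = 0"
proof -
  define U where "U = {w. 0 < Re w \<and> \<bar>Im w\<bar> < p + q}"
  have U: "U = {w. Re w > 0} \<inter> ({w. Im w < p + q} \<inter> {w. Im w > - (p + q)})" by (auto simp: U_def)
  have oU: "open U" unfolding U by (intro open_Int open_halfspace_Re_gt open_halfspace_Im_lt open_halfspace_Im_gt)
  have cU: "convex U" unfolding U
    by (intro convex_Int convex_halfspace_Re_gt convex_halfspace_Im_lt convex_halfspace_Im_gt)
  have vert: "D (Complex r y) = D (Complex r 0)" if "r > 0" "\<bar>y\<bar> < p + q" for r y
  proof (rule two_periods_imp_constant[OF p q irr _ _ _ that(2)])
    show "continuous_on {-(p+q)<..<p+q} (\<lambda>y. D (Complex r y))"
      by (rule continuous_on_compose2[OF holomorphic_on_imp_continuous_on[OF hol]])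
         (use that in \<open>auto simp: Complex_eq intro!: continuous_intros\<close>)
    show "D (Complex r (y + p)) = D (Complex r (y - p))" if "\<bar>y\<bar> < q" for y
      using per_p[of "Complex r y"] that \<open>r > 0\<close> by (simp add: Complex_eq algebra_simps)
    show "D (Complex r (y + q)) = D (Complex r (y - q))" if "\<bar>y\<bar> < p" for y
      using per_q[of "Complex r y"] that \<open>r > 0\<close> by (simp add: Complex_eq algebra_simps)
  qed
  have "\<exists>C. \<forall>w\<in>U. D w = C"
  proof (rule has_field_derivative_zero_constant[OF cU])
    fix w assume "w \<in> U"
    then obtain D' where D': "(D has_field_derivative D') (at w)"
      using hol oU unfolding U_def[symmetric] by (auto simp: holomorphic_on_open)
    have 1: "((\<lambda>t. w + \<i> * of_real t) has_vector_derivative \<i>) (at 0)"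
      by (auto intro!: derivative_eq_intros)
    have "((D \<circ> (\<lambda>t. w + \<i> * of_real t)) has_vector_derivative \<i> * D') (at 0)"
      by (rule field_vector_diff_chain_at[OF 1]) (use D' in simp)
    moreover have "((D \<circ> (\<lambda>t. w + \<i> * of_real t)) has_vector_derivative 0) (at 0)"
    proof (rule has_vector_derivative_transform_within_open[OF has_vector_derivative_const])
      define e where "e = p + q - \<bar>Im w\<bar>"
      show "open {-e<..<e}" "0 \<in> {-e<..<e}" using \<open>w \<in> U\<close> by (auto simp: e_def U_def)
      fix t assume t: "t \<in> {-e<..<e}"
      have "D (Complex (Re w) (Im w + t)) = D (Complex (Re w) 0)"
        by (rule vert) (use t \<open>w \<in> U\<close> in \<open>auto simp: e_def U_def\<close>)
      moreover have "w + \<i> * of_real t = Complex (Re w) (Im w + t)" by (simp add: complex_eq_iff)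
      ultimately show "D (Complex (Re w) 0) = (D \<circ> (\<lambda>t. w + \<i> * of_real t)) t" by simp
    qed
    ultimately have "\<i> * D' = 0" by (rule vector_derivative_unique_at)
    thus "(D has_field_derivative 0) (at w within U)"
      using D' by (auto intro: has_field_derivative_at_within)
  qed
  then obtain C where C: "\<And>w. w \<in> U \<Longrightarrow> D w = C" by blast
  have "\<forall>\<^sub>F x in at_top. D (of_real x) = C"
    using eventually_gt_at_top[of 0] by eventually_elim (rule C, use p q in \<open>auto simp: U_def\<close>)
  hence "((\<lambda>x::real. D (of_real x)) \<longlongrightarrow> C) at_top" by (rule tendsto_eventually)
  with lim have "C = 0" using tendsto_unique trivial_limit_at_top_linorder by blast
  thus ?thesis using C[of w] w by (simp add: U_def)
qed

section \<open>Lower bounds for the small denominators\<close>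

text \<open>
  Only finitely many coprime pairs violate the bound with \<open>c = 1\<close>. Since \<open>x\<close> is irrational, a smaller
  \<open>c\<close> takes care of them. Cancelling common factors only decreases the denominator, so coprimality
  may be dropped.
\<close>
lemma not_liouville_exp_lower_bound:
  assumes x: "x \<notin> \<rat>" "x \<notin> liouville_exp" and b: "b > 1"
  obtains c where "c > 0" "\<And>p (q::nat). q > 0 \<Longrightarrow> c / b ^ q \<le> \<bar>x - real_of_int p / real q\<bar>"
proof -
  define X where "X = {(p :: int, q :: nat). q > 0 \<and> coprime p (int q) \<and> \<bar>x - real_of_int p / real q\<bar> < 1 / b ^ q}"
  have fin: "finite X" using x b unfolding liouville_exp_def X_def by (auto dest!: spec[of _ b])
  define c where "c = Min (insert 1 ((\<lambda>(p, q). \<bar>x - real_of_int p / real q\<bar>) ` X))"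
  have ne: "x \<noteq> real_of_int p / real q" for p q using x(1) by auto
  have "c > 0" unfolding c_def using fin ne by (subst Min_gr_iff) (auto simp: case_prod_beta)
  have c1: "c \<le> 1" unfolding c_def using fin by (intro Min_le) auto
  have cX: "c \<le> \<bar>x - real_of_int p / real q\<bar>" if "(p, q) \<in> X" for p q
    unfolding c_def using fin that by (intro Min_le) (auto intro!: image_eqI[of _ _ "(p, q)"])
  have cop: "c / b ^ q \<le> \<bar>x - real_of_int p / real q\<bar>" if "q > 0" "coprime p (int q)" for p q
  proof (cases "(p, q) \<in> X")
    case True
    have "c / b ^ q \<le> c / 1" using \<open>c > 0\<close> b by (intro divide_left_mono) auto
    thus ?thesis using cX[OF True] by simp
  next
    case False
    hence "1 / b ^ q \<le> \<bar>x - real_of_int p / real q\<bar>" using that by (auto simp: X_def)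
    moreover have "c / b ^ q \<le> 1 / b ^ q" using c1 b by (intro divide_right_mono) auto
    ultimately show ?thesis by linarith
  qed
  show ?thesis
  proof (rule that[OF \<open>c > 0\<close>])
    fix p and q :: nat assume q: "q > 0"
    define g where "g = gcd p (int q)"
    have g: "g > 0" using q by (simp add: g_def)
    obtain p' q' where pq: "p = p' * g" "int q = q' * g" "coprime p' q'"
      unfolding g_def using gcd_coprime_exists[of p "int q"] q by auto
    have "q' > 0" using pq(2) q g by (metis of_nat_0_less_iff zero_less_mult_pos2)
    have "q' * 1 \<le> q' * g" using \<open>q' > 0\<close> g by (intro mult_left_mono) auto
    hence q'q: "nat q' \<le> q" using pq(2) by linarith
    have "real q = of_int (q' * g)" using pq(2) by (metis of_int_of_nat_eq)
    hence "real_of_int p / real q = real_of_int p' / real (nat q')"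
      using \<open>q' > 0\<close> g unfolding pq(1) by (simp add: field_simps)
    moreover have "c / b ^ q \<le> c / b ^ nat q'"
      using \<open>c > 0\<close> b q'q by (intro divide_left_mono power_increasing mult_pos_pos) auto
    moreover have "c / b ^ nat q' \<le> \<bar>x - real_of_int p' / real (nat q')\<bar>"
      using pq(3) \<open>q' > 0\<close> by (intro cop) auto
    ultimately show "c / b ^ q \<le> \<bar>x - real_of_int p / real q\<bar>" by simp
  qed
qed

text \<open>
  A crude form of Jordan's inequality: up to \<open>\<pi>/3\<close> the derivative \<open>cos\<close> is at least \<open>1/2\<close>, and beyond
  that \<open>sin u \<ge> 1/2\<close>.
\<close>
lemma sin_ge_quarter:
  fixes u :: real
  assumes "0 \<le> u" "u \<le> pi / 2"
  shows "u / 4 \<le> sin u"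
proof (cases "u \<le> pi / 3")
  case True
  show ?thesis
  proof (cases "u = 0")
    case False
    then obtain z where z: "0 < z" "z < u" "sin u - sin 0 = (u - 0) * cos z"
      using MVT2[of 0 u sin cos] assms by (auto intro: DERIV_sin)
    have "cos (pi / 3) \<le> cos z" using z True pi_gt_zero by (intro cos_monotone_0_pi_le) auto
    hence "1 / 2 \<le> cos z" by (simp add: cos_60)
    hence "u * (1 / 2) \<le> u * cos z" using assms by (intro mult_left_mono) auto
    thus ?thesis using z assms by simp
  qed simp
next
  case False
  have "sin (pi / 6) \<le> sin u" using False assms by (intro sin_monotone_2pi_le) auto
  moreover have "u / 4 \<le> 1 / 2" using assms pi_less_4 by linarith
  ultimately show ?thesis by (simp add: sin_30)
qed

lemma abs_sin_pi_mult_ge: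
  fixes x :: real
  shows "\<bar>x - of_int (round x)\<bar> / 2 \<le> \<bar>sin (pi * x)\<bar>"
proof -
  define y where "y = x - of_int (round x)"
  have y: "\<bar>y\<bar> \<le> 1 / 2" unfolding y_def using of_int_round_abs_le[of x] by (simp add: abs_minus_commute)
  have "\<bar>sin (pi * x)\<bar> = \<bar>sin (pi * \<bar>y\<bar>)\<bar>"
  proof -
    have "pi * x = pi * y + pi * of_int (round x)" by (simp add: y_def algebra_simps)
    hence "\<bar>sin (pi * x)\<bar> = \<bar>sin (pi * y)\<bar>"
      by (simp add: sin_add abs_mult sin_npi_int cos_npi_int)
    thus ?thesis by (cases "y \<ge> 0") auto
  qed
  moreover have "pi * \<bar>y\<bar> / 4 \<le> sin (pi * \<bar>y\<bar>)"
    using y mult_left_mono[OF y, of pi] by (intro sin_ge_quarter) auto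
  moreover have "2 * \<bar>y\<bar> \<le> pi * \<bar>y\<bar>" using pi_ge_two by (intro mult_right_mono) auto
  ultimately show ?thesis unfolding y_def by linarith
qed

text \<open>
  The condition under which dividing by the sines does not shrink the radius of convergence of a
  power series below \<open>1\<close>.
\<close>
definition subexp_sin_lower_bound :: "real \<Rightarrow> bool" where
  "subexp_sin_lower_bound x \<longleftrightarrow> (\<forall>b>1. \<exists>c>0. \<forall>k>0. c / b ^ k \<le> \<bar>sin (pi * real k * x)\<bar>)"

lemma subexp_sin_lower_bound_self:
  assumes "x \<notin> \<rat>" "x \<notin> liouville_exp"
  shows "subexp_sin_lower_bound x"
  unfolding subexp_sin_lower_bound_def
proof (intro allI impI)
  fix b :: real assume b: "b > 1"
  obtain c where c: "c > 0" "\<And>p (q::nat). q > 0 \<Longrightarrow> c / b ^ q \<le> \<bar>x - real_of_int p / real q\<bar>"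
    by (rule not_liouville_exp_lower_bound[OF assms b]) blast
  show "\<exists>c>0. \<forall>k>0. c / b ^ k \<le> \<bar>sin (pi * real k * x)\<bar>"
  proof (intro exI[of _ "c / 2"] conjI allI impI)
    fix k :: nat assume k: "k > 0"
    define m where "m = round (real k * x)"
    have "c / b ^ k \<le> 1 * \<bar>x - of_int m / real k\<bar>" using c(2)[OF k, of m] by simp
    also have "\<dots> \<le> real k * \<bar>x - of_int m / real k\<bar>" using k by (intro mult_right_mono) auto
    also have "\<dots> = \<bar>real k * (x - of_int m / real k)\<bar>" by (simp add: abs_mult)
    also have "real k * (x - of_int m / real k) = real k * x - of_int m" using k by (simp add: field_simps)
    finally have "c / b ^ k / 2 \<le> \<bar>real k * x - of_int m\<bar> / 2" by simp
    also have "\<dots> \<le> \<bar>sin (pi * (real k * x))\<bar>" unfolding m_def by (rule abs_sin_pi_mult_ge)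
    finally show "c / 2 / b ^ k \<le> \<bar>sin (pi * real k * x)\<bar>" by (simp add: mult.assoc)
  qed (use c in auto)
qed

text \<open>
  The same approximations of \<open>x\<close> control \<open>1/x\<close>: for \<open>m > 0\<close>, \<open>k/x - m\<close> equals \<open>m/x\<close> times \<open>k/m - x\<close>.
  Here \<open>m\<close> plays the part of the denominator, and \<open>m \<le> k/x + 1\<close> turns a bound by powers of \<open>b\<close> with
  exponent \<open>m\<close> into one by powers of \<open>B = b^{1/x}\<close> with exponent \<open>k\<close>.
\<close>
lemma subexp_sin_lower_bound_inverse:
  assumes "x \<notin> \<rat>" "x \<notin> liouville_exp" and x: "x > 0"
  shows "subexp_sin_lower_bound (1 / x)"
  unfolding subexp_sin_lower_bound_def
proof (intro allI impI)
  fix B :: real assume B: "B > 1"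
  define b where "b = B powr x"
  have b: "b > 1" using B x by (simp add: b_def)
  obtain c where c: "c > 0" "\<And>p (q::nat). q > 0 \<Longrightarrow> c / b ^ q \<le> \<bar>x - real_of_int p / real q\<bar>"
    by (rule not_liouville_exp_lower_bound[OF assms(1,2) b]) blast
  define C where "C = min (1 / x) (c / (x * b))"
  have C: "C > 0" using x c b by (simp add: C_def)
  show "\<exists>c>0. \<forall>k>0. c / B ^ k \<le> \<bar>sin (pi * real k * (1 / x))\<bar>"
  proof (intro exI[of _ "C / 2"] conjI allI impI)
    fix k :: nat assume k: "k > 0"
    define m where "m = round (real k / x)"
    have "C / B ^ k \<le> \<bar>real k / x - of_int m\<bar>"
    proof (cases "m > 0")
      case False
      have "C / B ^ k \<le> C / 1" using C B by (intro divide_left_mono) auto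
      also have "\<dots> \<le> 1 / x" by (simp add: C_def)
      also have "\<dots> \<le> real k / x" using k x by (intro divide_right_mono) auto
      also have "\<dots> \<le> real k / x - of_int m" using False by simp
      finally show ?thesis by linarith
    next
      case True
      define n where "n = nat m"
      have n: "n > 0" "real n = of_int m" using True by (auto simp: n_def)
      have "real n \<le> real k / x + 1"
        using of_int_round_le[of "real k / x"] unfolding n m_def by simp
      hence "b powr real n \<le> b powr (real k / x + 1)" using b by (intro powr_mono) auto
      also have "\<dots> = B powr (real k) * b"
        using x B b by (simp add: powr_add b_def powr_powr)
      finally have bn: "b ^ n \<le> B ^ k * b" using b B by (simp add: powr_realpow)
      have "C / B ^ k \<le> c / (x * b) / B ^ k" using B by (intro divide_right_mono) (auto simp: C_def)
      also have "\<dots> = c / x / (B ^ k * b)" using x b B by (simp add: field_simps)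
      also have "\<dots> \<le> c / x / b ^ n" using bn c x b B by (intro divide_left_mono) auto
      also have "\<dots> = 1 / x * (c / b ^ n)" by simp
      also have "\<dots> \<le> real n / x * \<bar>x - of_int (int k) / real n\<bar>"
        using n x c b c(2)[OF n(1), of "int k"] by (intro mult_mono divide_right_mono) auto
      also have "\<dots> = \<bar>real n / x * (x - of_int (int k) / real n)\<bar>" using x by (simp add: abs_mult)
      also have "real n / x * (x - of_int (int k) / real n) = of_int m - real k / x"
        using n x by (simp add: field_simps)
      finally show ?thesis by (simp add: abs_minus_commute)
    qed
    hence "C / B ^ k / 2 \<le> \<bar>real k / x - of_int m\<bar> / 2" by simp
    also have "\<dots> \<le> \<bar>sin (pi * (real k / x))\<bar>" unfolding m_def by (rule abs_sin_pi_mult_ge)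
    finally show "C / 2 / B ^ k \<le> \<bar>sin (pi * real k * (1 / x))\<bar>" by simp
  qed (use C in auto)
qed

section \<open>The series expansion of the logarithm of the double sine function\<close>

text \<open>
  For \<open>k = 0\<close> the division by \<open>0\<close> yields the coefficient \<open>0\<close>, so the power series has no constant term.
\<close>
definition cosec_coeff :: "real \<Rightarrow> nat \<Rightarrow> complex" where
  "cosec_coeff x k = of_real (pi * (-1) ^ k / (real k * sin (pi * real k * x)))"

definition cosec_series :: "real \<Rightarrow> complex \<Rightarrow> complex" where
  "cosec_series x u = (\<Sum>k. cosec_coeff x k * u ^ k)"

text \<open>
  Choosing \<open>b > 1\<close> with \<open>b \<bar>u\<bar> < 1\<close>, the growth \<open>b^k\<close> of the coefficients is absorbed by \<open>u^k\<close>.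
\<close>
lemma cosec_series_sums:
  assumes x: "subexp_sin_lower_bound x" and u: "norm u < 1"
  shows "(\<lambda>k. cosec_coeff x k * u ^ k) sums cosec_series x u"
proof -
  define b where "b = 2 / (1 + norm u)"
  have pos: "1 + norm u > 0" by (smt (verit) norm_ge_zero)
  have b: "b > 1" "norm u * b < 1" using u pos by (auto simp: b_def field_simps)
  obtain c where c: "c > 0" "\<And>k. k > 0 \<Longrightarrow> c / b ^ k \<le> \<bar>sin (pi * real k * x)\<bar>"
    using x b(1) unfolding subexp_sin_lower_bound_def by blast
  have bound: "norm (cosec_coeff x k * u ^ k) \<le> pi / c * (norm u * b) ^ k" for k
  proof (cases "k = 0")
    case True
    thus ?thesis using c by (simp add: cosec_coeff_def)
  next
    case False
    have pos: "0 < c / b ^ k" using c b by simp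
    have le: "1 * (c / b ^ k) \<le> real k * \<bar>sin (pi * real k * x)\<bar>"
      using False c(2)[of k] pos by (intro mult_mono) auto
    hence P: "0 < real k * \<bar>sin (pi * real k * x)\<bar>" using pos by linarith
    hence "pi / (real k * \<bar>sin (pi * real k * x)\<bar>) \<le> pi / (c / b ^ k)"
      using le by (intro divide_left_mono mult_pos_pos[OF P pos]) simp_all
    hence "pi / (real k * \<bar>sin (pi * real k * x)\<bar>) * norm u ^ k \<le> pi / (c / b ^ k) * norm u ^ k"
      by (intro mult_right_mono) auto
    thus ?thesis
      by (simp add: cosec_coeff_def norm_mult norm_power norm_divide power_mult_distrib abs_mult mult_ac)
  qed
  have "summable (\<lambda>k. pi / c * (norm u * b) ^ k)"
    using b by (intro summable_mult summable_geometric) (auto simp: abs_mult)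
  hence "summable (\<lambda>k. cosec_coeff x k * u ^ k)"
    by (rule summable_comparison_test'[where N = 0]) (rule bound)
  thus ?thesis unfolding cosec_series_def by (rule summable_sums)
qed

lemma cosec_series_holomorphic:
  assumes x: "subexp_sin_lower_bound x"
  shows "cosec_series x holomorphic_on ball 0 1"
  by (rule power_series_holomorphic[where a = "cosec_coeff x"])
     (use cosec_series_sums[OF x] in auto)

text \<open>
  Turning \<open>u\<close> by the angles \<open>\<plusminus>\<pi>x\<close> produces the factor \<open>-2\<i> sin (\<pi>kx)\<close>, which cancels the denominator
  and leaves the logarithmic series.
\<close>
lemma cosec_series_shift:
  assumes x: "subexp_sin_lower_bound x" and u: "norm u < 1"
  shows "cosec_series x (u * exp (- \<i> * of_real (pi * x))) - cosec_series x (u * exp (\<i> * of_real (pi * x)))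
           = 2 * of_real pi * \<i> * Ln (1 + u)"
proof (rule sums_unique2)
  have n: "norm (u * exp (- \<i> * of_real (pi * x))) < 1" "norm (u * exp (\<i> * of_real (pi * x))) < 1"
    using u by (auto simp: norm_mult)
  show "(\<lambda>k. cosec_coeff x k * (u * exp (- \<i> * of_real (pi * x))) ^ k - cosec_coeff x k * (u * exp (\<i> * of_real (pi * x))) ^ k)
     sums (cosec_series x (u * exp (- \<i> * of_real (pi * x))) - cosec_series x (u * exp (\<i> * of_real (pi * x))))"
    by (intro sums_diff cosec_series_sums[OF x] n)
  have "(\<lambda>k. 2 * of_real pi * \<i> * (- ((- u) ^ k) / of_nat k)) sums (2 * of_real pi * \<i> * Ln (1 + u))"
    by (intro sums_mult Ln_series' u)
  also have "(\<lambda>k. 2 * of_real pi * \<i> * (- ((- u) ^ k) / of_nat k)) =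
      (\<lambda>k. cosec_coeff x k * (u * exp (- \<i> * of_real (pi * x))) ^ k - cosec_coeff x k * (u * exp (\<i> * of_real (pi * x))) ^ k)"
  proof
    fix k
    define S where "S = sin (complex_of_real (pi * real k * x))"
    show "2 * of_real pi * \<i> * (- ((- u) ^ k) / of_nat k) =
      cosec_coeff x k * (u * exp (- \<i> * of_real (pi * x))) ^ k - cosec_coeff x k * (u * exp (\<i> * of_real (pi * x))) ^ k"
    proof (cases "k = 0")
      case False
      obtain c where c: "c > 0" "\<And>k. k > 0 \<Longrightarrow> c / 2 ^ k \<le> \<bar>sin (pi * real k * x)\<bar>"
        using x unfolding subexp_sin_lower_bound_def by (metis one_less_numeral_iff semiring_norm(76))
      have "0 < c / 2 ^ k" using c by simp
      hence "sin (pi * real k * x) \<noteq> 0" using c(2)[of k] False by auto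
      hence S: "S \<noteq> 0" unfolding S_def sin_of_real by simp
      have coeff: "cosec_coeff x k = of_real pi * (-1) ^ k / (of_nat k * S)"
        unfolding cosec_coeff_def S_def sin_of_real by simp
      have e: "exp (- \<i> * of_real (pi * x)) ^ k = exp (- (\<i> * of_real (pi * real k * x)))"
              "exp (\<i> * of_real (pi * x)) ^ k = exp (\<i> * of_real (pi * real k * x))"
        unfolding exp_of_nat_mult[symmetric] by (simp_all add: mult_ac)
      have s: "exp (- (\<i> * of_real (pi * real k * x))) - exp (\<i> * of_real (pi * real k * x)) = - 2 * \<i> * S"
        unfolding S_def sin_exp_eq by simp
      have "cosec_coeff x k * (u * exp (- \<i> * of_real (pi * x))) ^ k - cosec_coeff x k * (u * exp (\<i> * of_real (pi * x))) ^ k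
        = cosec_coeff x k * u ^ k * (exp (- (\<i> * of_real (pi * real k * x))) - exp (\<i> * of_real (pi * real k * x)))"
        unfolding power_mult_distrib e by (simp add: algebra_simps)
      also have "\<dots> = 2 * of_real pi * \<i> * (- ((- u) ^ k) / of_nat k)"
        unfolding s coeff power_minus[of u] using S False by (simp add: field_simps)
      finally show ?thesis ..
    qed (simp add: cosec_coeff_def)
  qed
  finally show "(\<lambda>k. cosec_coeff x k * (u * exp (- \<i> * of_real (pi * x))) ^ k - cosec_coeff x k * (u * exp (\<i> * of_real (pi * x))) ^ k)
     sums (2 * of_real pi * \<i> * Ln (1 + u))" .
qed

lemma cosec_series_exp_tendsto_0:
  assumes x: "subexp_sin_lower_bound x" and a: "a > 0"
  shows "((\<lambda>t. cosec_series x (exp (- of_real a * of_real t))) \<longlongrightarrow> 0) at_top"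
proof -
  have "isCont (cosec_series x) 0"
    using holomorphic_on_imp_continuous_on[OF cosec_series_holomorphic[OF x]]
    by (simp add: continuous_on_eq_continuous_at)
  moreover have "cosec_series x 0 = 0"
    using powser_zero[of "cosec_coeff x"] by (simp add: cosec_series_def cosec_coeff_def)
  moreover have "((\<lambda>t. of_real (exp (- (a * t)))) \<longlongrightarrow> complex_of_real 0) at_top"
    by (intro tendsto_of_real filterlim_compose[OF exp_at_bot] filterlim_compose[OF filterlim_uminus_at_bot_at_top]
          filterlim_tendsto_pos_mult_at_top[OF tendsto_const _ filterlim_ident]) (use a in auto)
  ultimately have "((\<lambda>t. cosec_series x (of_real (exp (- (a * t))))) \<longlongrightarrow> 0) at_top"
    using isCont_tendsto_compose[of 0 "cosec_series x"] by fastforce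
  thus ?thesis
    by (simp add: exp_of_real flip: of_real_mult of_real_minus)
qed

text \<open>
  Each of the two shifts leaves one of the two series invariant and acts on the other as the
  corresponding difference equation prescribes. The difference \<open>D\<close> of the two sides therefore
  satisfies the hypotheses of \<open>holomorphic_two_periods_eq_0\<close> with \<open>p = \<pi>\<close> and \<open>q = \<pi>/\<alpha>\<close>.
\<close>
lemma log_dsine_series:
  assumes \<alpha>: "\<alpha> > 0" "\<alpha> \<notin> \<rat>" "\<alpha> \<notin> liouville_exp"
    and w: "0 < Re w" "\<bar>Im w\<bar> < pi + pi / \<alpha>"
  shows "log_dsine 1 \<alpha> w = cosec_series (1 / \<alpha>) (exp (- w)) + cosec_series \<alpha> (exp (- of_real \<alpha> * w))"
proof -
  have x1: "subexp_sin_lower_bound \<alpha>" and x2: "subexp_sin_lower_bound (1 / \<alpha>)"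
    using subexp_sin_lower_bound_self subexp_sin_lower_bound_inverse \<alpha> by auto
  define D where "D = (\<lambda>w. log_dsine 1 \<alpha> w - cosec_series (1 / \<alpha>) (exp (- w)) - cosec_series \<alpha> (exp (- of_real \<alpha> * w)))"
  have n: "norm (exp (- w)) < 1" "norm (exp (- of_real \<alpha> * w)) < 1" if "0 < Re w" for w
    using that \<alpha>(1) by auto
  have pi1: "exp (w + \<i> * of_real pi) = exp (w - \<i> * of_real pi)" for w
    by (simp add: exp_add exp_diff exp_minus)
  have "D w = 0"
  proof (rule holomorphic_two_periods_eq_0[where p = pi and q = "pi / \<alpha>", OF _ _ _ _ _ _ _ w])
    show "pi / (pi / \<alpha>) \<notin> \<rat>" using \<alpha> by simp
    have "log_dsine 1 \<alpha> holomorphic_on {w. 0 < Re w \<and> \<bar>Im w\<bar> < pi + pi / \<alpha>}"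
      by (rule holomorphic_on_subset[OF holomorphic_log_dsine]) (use \<alpha> in auto)
    moreover have "(\<lambda>w. cosec_series (1 / \<alpha>) (exp (- w))) holomorphic_on {w. 0 < Re w \<and> \<bar>Im w\<bar> < pi + pi / \<alpha>}"
      by (rule holomorphic_on_compose_gen[unfolded o_def, OF _ cosec_series_holomorphic[OF x2]])
         (use n in \<open>auto intro!: holomorphic_intros\<close>)
    moreover have "(\<lambda>w. cosec_series \<alpha> (exp (- of_real \<alpha> * w))) holomorphic_on {w. 0 < Re w \<and> \<bar>Im w\<bar> < pi + pi / \<alpha>}"
      by (rule holomorphic_on_compose_gen[unfolded o_def, OF _ cosec_series_holomorphic[OF x1]])
         (use n in \<open>auto intro!: holomorphic_intros\<close>)
    ultimately show "D holomorphic_on {w. 0 < Re w \<and> \<bar>Im w\<bar> < pi + pi / \<alpha>}"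
      unfolding D_def by (intro holomorphic_intros)
    show "D (w + \<i> * of_real pi) = D (w - \<i> * of_real pi)" if w: "0 < Re w" "\<bar>Im w\<bar> < pi / \<alpha>" for w
    proof -
      have "log_dsine 1 \<alpha> (w + \<i> * of_real pi) - log_dsine 1 \<alpha> (w - \<i> * of_real pi) = 2 * of_real pi * \<i> * Ln (1 + exp (- of_real \<alpha> * w))"
        using log_dsine_shift[of 1 \<alpha> w] \<alpha> w by simp
      also have "\<dots> = cosec_series \<alpha> (exp (- of_real \<alpha> * w) * exp (- \<i> * of_real (pi * \<alpha>))) - cosec_series \<alpha> (exp (- of_real \<alpha> * w) * exp (\<i> * of_real (pi * \<alpha>)))"
        by (rule cosec_series_shift[OF x1 n(2)[OF w(1)], symmetric])
      also have "exp (- of_real \<alpha> * w) * exp (- \<i> * of_real (pi * \<alpha>)) = exp (- of_real \<alpha> * (w + \<i> * of_real pi))"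
        by (simp add: algebra_simps flip: exp_add)
      also have "exp (- of_real \<alpha> * w) * exp (\<i> * of_real (pi * \<alpha>)) = exp (- of_real \<alpha> * (w - \<i> * of_real pi))"
        by (simp add: algebra_simps flip: exp_add)
      finally show ?thesis
        using pi1[of "- w"] by (simp add: D_def algebra_simps)
    qed
    show "D (w + \<i> * of_real (pi / \<alpha>)) = D (w - \<i> * of_real (pi / \<alpha>))" if w: "0 < Re w" "\<bar>Im w\<bar> < pi" for w
    proof -
      have "log_dsine 1 \<alpha> (w + \<i> * of_real (pi / \<alpha>)) - log_dsine 1 \<alpha> (w - \<i> * of_real (pi / \<alpha>)) = 2 * of_real pi * \<i> * Ln (1 + exp (- w))"
        using log_dsine_shift[of \<alpha> 1 w] \<alpha> w by (simp add: log_dsine_commute[of 1 \<alpha>])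
      also have "\<dots> = cosec_series (1 / \<alpha>) (exp (- w) * exp (- \<i> * of_real (pi * (1 / \<alpha>)))) - cosec_series (1 / \<alpha>) (exp (- w) * exp (\<i> * of_real (pi * (1 / \<alpha>))))"
        by (rule cosec_series_shift[OF x2 n(1)[OF w(1)], symmetric])
      also have "exp (- w) * exp (- \<i> * of_real (pi * (1 / \<alpha>))) = exp (- (w + \<i> * of_real (pi / \<alpha>)))"
        by (simp add: algebra_simps flip: exp_add)
      also have "exp (- w) * exp (\<i> * of_real (pi * (1 / \<alpha>))) = exp (- (w - \<i> * of_real (pi / \<alpha>)))"
        by (simp add: algebra_simps flip: exp_add)
      finally have 1: "log_dsine 1 \<alpha> (w + \<i> * of_real (pi / \<alpha>)) - log_dsine 1 \<alpha> (w - \<i> * of_real (pi / \<alpha>)) =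
        cosec_series (1 / \<alpha>) (exp (- (w + \<i> * of_real (pi / \<alpha>)))) - cosec_series (1 / \<alpha>) (exp (- (w - \<i> * of_real (pi / \<alpha>))))" .
      have "- of_real \<alpha> * (w + \<i> * of_real (pi / \<alpha>)) = - of_real \<alpha> * w - \<i> * of_real pi"
           "- of_real \<alpha> * (w - \<i> * of_real (pi / \<alpha>)) = - of_real \<alpha> * w + \<i> * of_real pi"
        using \<alpha>(1) by (simp_all add: algebra_simps)
      hence 2: "exp (- of_real \<alpha> * (w + \<i> * of_real (pi / \<alpha>))) = exp (- of_real \<alpha> * (w - \<i> * of_real (pi / \<alpha>)))"
        using pi1[of "- of_real \<alpha> * w"] by simp
      show ?thesis using 1 unfolding D_def 2 by (simp add: algebra_simps)
    qed
    have "((\<lambda>x. log_dsine 1 \<alpha> (Complex x 0) - cosec_series (1 / \<alpha>) (exp (- of_real 1 * of_real x)) - cosec_series \<alpha> (exp (- of_real \<alpha> * of_real x))) \<longlongrightarrow> 0 - 0 - 0) at_top"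
      using \<alpha> by (intro tendsto_diff log_dsine_tendsto_0 cosec_series_exp_tendsto_0 x1 x2) (auto simp: add_pos_pos)
    thus "((\<lambda>x. D (of_real x)) \<longlongrightarrow> 0) at_top" by (simp add: D_def flip: complex_of_real_def)
  qed (use \<alpha> in auto)
  thus ?thesis by (simp add: D_def algebra_simps)
qed

section \<open>The function \<open>\<phi>\<close> on the positive half-line\<close>

definition log_phi :: "real \<Rightarrow> real \<Rightarrow> complex \<Rightarrow> complex" where
  "log_phi \<alpha> \<rho> \<zeta> = - (log_dsine 1 \<alpha> (\<i> * of_real (pi * \<rho>) - \<zeta>) - log_dsine 1 \<alpha> (- \<i> * of_real (pi * \<rho>) - \<zeta>)) / (2 * of_real pi * \<i>)"

text \<open>
  The fundamental theorem of calculus: \<open>log_phi\<close> at \<open>ln u\<close> is a primitive of the integrand and tends to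
  \<open>0\<close> as \<open>u \<rightarrow> 0\<close>, that is, as \<open>- ln u \<rightarrow> \<infinity>\<close>. The decay of the derivative of \<open>log_dsine\<close> bounds the
  integrand by a multiple of \<open>u^{c - 1}\<close> with \<open>c > 0\<close>, which is integrable near \<open>0\<close>.
\<close>
lemma phi_pos_eq_exp_log_phi:
  assumes \<alpha>: "\<alpha> > 0" and \<rho>: "0 < \<rho>" "\<rho> < 1" and x: "x > 0"
  shows "phi_pos \<alpha> \<rho> x = exp (log_phi \<alpha> \<rho> (of_real (ln x)))"
proof -
  define y where "y = pi * \<rho>"
  have y: "0 < y" "y < pi" using \<rho> by (auto simp: y_def)
  define B where "B = pi + pi / \<alpha>"
  have yB: "\<bar>y\<bar> < B" "\<bar>-y\<bar> < B" using y divide_pos_pos[OF pi_gt_zero \<alpha>] by (auto simp: B_def)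
  define S where "S = {w. \<bar>Im w\<bar> < B}"
  have S: "S = {s. Im s < B} \<inter> {s. Im s > -B}" by (auto simp: S_def)
  have oS: "open S" unfolding S by (intro open_Int open_halfspace_Im_lt open_halfspace_Im_gt)
  have dE: "(log_dsine 1 \<alpha> has_field_derivative log_dsine' 1 \<alpha> w) (at w)" if "w \<in> S" for w
    using has_field_derivative_log_dsine[of 1 \<alpha> w] \<alpha> that by (simp add: S_def B_def)
  have "deriv (log_dsine 1 \<alpha>) holomorphic_on S"
    by (rule holomorphic_deriv[OF _ oS]) (use dE oS in \<open>auto simp: holomorphic_on_open\<close>)
  hence "log_dsine' 1 \<alpha> holomorphic_on S"
    by (rule holomorphic_transform) (use dE in \<open>auto intro: DERIV_imp_deriv\<close>)
  hence cont': "continuous_on S (log_dsine' 1 \<alpha>)" by (rule holomorphic_on_imp_continuous_on)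
  have inS: "Complex a y \<in> S" "Complex a (- y) \<in> S" for a using yB by (auto simp: S_def)
  have line: "continuous_on {0<..} (\<lambda>u. Complex (- ln u) a)" for a
    unfolding Complex_eq by (intro continuous_intros) auto
  define c where "c = min 1 \<alpha> / 2"
  have c: "c > 0" using \<alpha> by (simp add: c_def)
  define G where "G = (\<lambda>u. log_phi \<alpha> \<rho> (of_real (ln u)))"
  define g where "g = (\<lambda>u. 1 / (2 * of_real pi * \<i> * of_real u) *
       (F_int \<alpha> (of_real pi * \<i> * of_real \<rho> - of_real (ln u)) -
        F_int \<alpha> (- of_real pi * \<i> * of_real \<rho> - of_real (ln u))))"
  have c1: "of_real pi * \<i> * of_real \<rho> - of_real (ln u) = Complex (- ln u) y"
           "- of_real pi * \<i> * of_real \<rho> - of_real (ln u) = Complex (- ln u) (- y)" for u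
    by (simp_all add: y_def complex_eq_iff)
  have c2: "\<i> * of_real (pi * \<rho>) - of_real (ln u) = Complex (- ln u) y"
           "- \<i> * of_real (pi * \<rho>) - of_real (ln u) = Complex (- ln u) (- y)" for u
    by (simp_all add: y_def complex_eq_iff)
  have g_eq: "g u = 1 / (2 * of_real pi * \<i> * of_real u) * (log_dsine' 1 \<alpha> (Complex (- ln u) y) - log_dsine' 1 \<alpha> (Complex (- ln u) (- y)))" for u
    unfolding g_def c1 using y by (subst (1 2) F_int_eq_log_dsine'[OF \<alpha>]) auto
  have G_eq: "G u = - (log_dsine 1 \<alpha> (Complex (- ln u) y) - log_dsine 1 \<alpha> (Complex (- ln u) (- y))) / (2 * of_real pi * \<i>)" for u
    unfolding G_def log_phi_def c2 ..
  have cont_g: "isCont g u" if "u > 0" for u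
  proof -
    have "continuous_on {0<..} g"
      unfolding g_eq[abs_def]
      by (intro continuous_intros continuous_on_compose2[OF cont' line]) (auto simp: inS)
    thus ?thesis using that by (simp add: continuous_on_eq_continuous_at)
  qed
  have "(LBINT u=ereal 0..ereal x. g u) = G x - 0"
  proof (rule interval_integral_FTC_integrable)
    fix u :: real assume "ereal 0 < ereal u"
    hence u: "u > 0" by simp
    show "isCont g u" by (rule cont_g[OF u])
    have dv: "((\<lambda>u. log_dsine 1 \<alpha> (Complex (- ln u) z)) has_vector_derivative (- of_real (1 / u) * log_dsine' 1 \<alpha> (Complex (- ln u) z))) (at u)"
      if z: "Complex (- ln u) z \<in> S" for z
    proof -
      have "((\<lambda>u. Complex (- ln u) z) has_vector_derivative (- of_real (1 / u))) (at u)"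
        unfolding Complex_eq using u by (auto intro!: derivative_eq_intros has_vector_derivative_real_field simp: has_real_derivative_iff_has_vector_derivative[symmetric])
      from field_vector_diff_chain_at[OF this dE[OF z]] show ?thesis by (simp add: o_def)
    qed
    have "(G has_vector_derivative - (- of_real (1 / u) * log_dsine' 1 \<alpha> (Complex (- ln u) y) - (- of_real (1 / u) * log_dsine' 1 \<alpha> (Complex (- ln u) (- y)))) / (2 * of_real pi * \<i>)) (at u)"
      unfolding G_eq[abs_def]
      by (intro has_vector_derivative_divide has_vector_derivative_minus has_vector_derivative_diff dv inS)
    also have "- (- of_real (1 / u) * log_dsine' 1 \<alpha> (Complex (- ln u) y) - (- of_real (1 / u) * log_dsine' 1 \<alpha> (Complex (- ln u) (- y)))) / (2 * of_real pi * \<i>) = g u"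
      unfolding g_eq using u by (simp add: field_simps)
    finally show "(G has_vector_derivative g u) (at u)" .
  next
    have decay: "\<exists>C. \<forall>t. norm (log_dsine' 1 \<alpha> (Complex t z)) \<le> C * exp (- c * t)" if "\<bar>z\<bar> < B" for z
    proof -
      have z: "\<bar>z\<bar> < pi / 1 + pi / \<alpha>" using that by (simp add: B_def)
      obtain C where "\<And>t. norm (log_dsine' 1 \<alpha> (Complex t z)) \<le> C * exp (- (min 1 \<alpha> / 2) * t)"
        by (rule log_dsine_decay[OF zero_less_one \<alpha> z]) blast
      thus ?thesis unfolding c_def by blast
    qed
    obtain C1 C2 where C1: "\<And>t. norm (log_dsine' 1 \<alpha> (Complex t y)) \<le> C1 * exp (- c * t)"
      and C2: "\<And>t. norm (log_dsine' 1 \<alpha> (Complex t (- y))) \<le> C2 * exp (- c * t)"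
      using decay[OF yB(1)] decay[OF yB(2)] by blast
    define K where "K = (C1 + C2) / (2 * pi)"
    have "(\<lambda>t. t powr (c - 1)) integrable_on {0..x}"
      by (rule integrable_on_powr_from_0) (use c x in auto)
    hence "(\<lambda>t. t powr (c - 1)) absolutely_integrable_on {0..x}"
      by (subst absolutely_integrable_on_iff_nonneg) auto
    from integrable_mult_right[OF this [unfolded set_integrable_def], of K]
    have majo: "integrable lborel (\<lambda>u. indicat_real {0..x} u *\<^sub>R (K * u powr (c - 1)))"
      by (subst (asm) integrable_completion) (auto simp: mult_ac)
    have "set_integrable lborel {0<..<x} g"
      unfolding set_integrable_def
    proof (rule Bochner_Integration.integrable_bound[OF majo])
      have "(\<lambda>u. indicator {0<..<x} u *\<^sub>R g u) \<in> borel_measurable borel"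
        by (rule borel_measurable_continuous_on_indicator)
           (use cont_g in \<open>auto intro!: continuous_at_imp_continuous_on\<close>)
      thus "(\<lambda>u. indicator {0<..<x} u *\<^sub>R g u) \<in> borel_measurable lborel" by simp
      have "norm (g u) \<le> K * u powr (c - 1)" if u: "0 < u" for u
      proof -
        have e: "exp (- c * (- ln u)) = u powr c" using u by (simp add: powr_def)
        have "norm (log_dsine' 1 \<alpha> (Complex (- ln u) y) - log_dsine' 1 \<alpha> (Complex (- ln u) (- y))) \<le> (C1 + C2) * u powr c"
          using norm_triangle_ineq4[of "log_dsine' 1 \<alpha> (Complex (- ln u) y)" "log_dsine' 1 \<alpha> (Complex (- ln u) (- y))"]
            C1[of "- ln u"] C2[of "- ln u"] unfolding e by (simp add: distrib_right)
        hence "norm (g u) \<le> (C1 + C2) * u powr c / (2 * pi * u)"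
          unfolding g_eq using u by (simp add: norm_mult norm_divide divide_right_mono)
        also have "\<dots> = K * u powr (c - 1)" using u by (simp add: K_def powr_diff)
        finally show ?thesis .
      qed
      note b = this
      show "AE u in lborel. norm (indicat_real {0<..<x} u *\<^sub>R g u) \<le> norm (indicat_real {0..x} u *\<^sub>R (K * u powr (c - 1)))"
      proof (rule AE_I2)
        fix u
        show "norm (indicat_real {0<..<x} u *\<^sub>R g u) \<le> norm (indicat_real {0..x} u *\<^sub>R (K * u powr (c - 1)))"
          using b[of u] by (cases "0 < u") (auto simp: indicator_def intro: order_trans[OF _ abs_ge_self])
      qed
    qed
    thus "set_integrable lborel (einterval (ereal 0) (ereal x)) g" by simp
    have "filterlim (\<lambda>u::real. - ln u) at_top (at_right 0)"
      using ln_at_0 by (simp add: filterlim_uminus_at_top)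
    from filterlim_compose[OF log_dsine_tendsto_0 this]
    have t0: "((\<lambda>u. log_dsine 1 \<alpha> (Complex (- ln u) z)) \<longlongrightarrow> 0) (at_right 0)" if "\<bar>z\<bar> < B" for z
      using that \<alpha> by (simp add: B_def)
    have "(G \<longlongrightarrow> - (0 - 0) / (2 * of_real pi * \<i>)) (at_right 0)"
      unfolding G_eq[abs_def] by (intro tendsto_intros t0 yB) auto
    thus "((G \<circ> real_of_ereal) \<longlongrightarrow> 0) (at_right (ereal 0))" by (simp add: ereal_tendsto_simps)
    have contE: "continuous_on S (log_dsine 1 \<alpha>)" using dE by (auto intro!: continuous_at_imp_continuous_on DERIV_isCont)
    have "continuous_on {0<..} G"
      unfolding G_eq[abs_def]
      by (intro continuous_intros continuous_on_compose2[OF contE line]) (auto simp: inS)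
    hence "isCont G x" using x by (simp add: continuous_on_eq_continuous_at)
    hence "(G \<longlongrightarrow> G x) (at_left x)" by (simp add: isCont_def filterlim_at_split)
    thus "((G \<circ> real_of_ereal) \<longlongrightarrow> G x) (at_left (ereal x))" by (simp add: ereal_tendsto_simps)
  qed (use x in simp)
  also have "(LBINT u=ereal 0..ereal x. g u) = (LINT u:{0<..<x}|lborel. g u)"
    using x by (simp add: interval_lebesgue_integral_le_eq)
  finally show ?thesis unfolding phi_pos_def g_def G_def by simp
qed

section \<open>Meromorphic continuation to the slit plane\<close>

definition dsine :: "real \<Rightarrow> complex \<Rightarrow> complex" where
  "dsine \<alpha> w = exp (log_dsine 1 \<alpha> w / (2 * of_real pi * \<i>))"

lemma dsine_shift:
  assumes \<alpha>: "\<alpha> > 0" and v: "\<bar>Im v\<bar> < pi / \<alpha>"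
  shows "dsine \<alpha> (v + \<i> * of_real pi) = dsine \<alpha> (v - \<i> * of_real pi) * (1 + exp (- of_real \<alpha> * v))"
proof -
  have "log_dsine 1 \<alpha> (v + \<i> * of_real pi) = log_dsine 1 \<alpha> (v - \<i> * of_real pi) + 2 * of_real pi * \<i> * Ln (1 + exp (- of_real \<alpha> * v))"
    using log_dsine_shift[of 1 \<alpha> v] \<alpha> v by (simp add: algebra_simps)
  hence "dsine \<alpha> (v + \<i> * of_real pi) = dsine \<alpha> (v - \<i> * of_real pi) * exp (Ln (1 + exp (- of_real \<alpha> * v)))"
    unfolding dsine_def by (simp add: add_divide_distrib exp_add)
  also have "exp (Ln (1 + exp (- of_real \<alpha> * v))) = 1 + exp (- of_real \<alpha> * v)"
  proof (rule exp_Ln, rule one_plus_exp_notin_nonpos_Reals(2))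
    show "\<bar>Im (- of_real \<alpha> * v)\<bar> < pi" using \<alpha> v by (simp add: abs_mult field_simps)
  qed
  finally show ?thesis .
qed

text \<open>
  The shift formula defines the continuations beyond \<open>Im w = \<pi>\<close> and \<open>Im w = -\<pi>\<close>. It holds on an
  overlap with the original strip \<open>\<bar>Im w\<bar> < \<pi> + \<pi>/\<alpha>\<close>, so the pieces fit together. The factor
  \<open>1 + e^{-\<alpha>(...)}\<close> has zeros: upwards they are zeros of \<open>dsine\<close>, downwards they are its poles, which is
  why there the reciprocal is continued.
\<close>
lemma dsine_continuations:
  assumes \<alpha>: "\<alpha> > 0"
  obtains A B where
    "A holomorphic_on {w. - pi < Im w \<and> Im w < 3 * pi}"
    "B holomorphic_on {w. - 3 * pi < Im w \<and> Im w < pi}"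
    "\<And>w. \<bar>Im w\<bar> < pi \<Longrightarrow> A w = dsine \<alpha> w"
    "\<And>w. \<bar>Im w\<bar> < pi \<Longrightarrow> B w = inverse (dsine \<alpha> w)"
proof -
  define r where "r = pi + pi / \<alpha>"
  have r: "r > pi" using \<alpha> by (simp add: r_def)
  define S where "S = {w. \<bar>Im w\<bar> < r}"
  define U where "U = {w. pi < Im w \<and> Im w < 3 * pi}"
  define V where "V = {w. - 3 * pi < Im w \<and> Im w < - pi}"
  have "S = {s. Im s < r} \<inter> {s. Im s > -r}" "U = {s. Im s < 3 * pi} \<inter> {s. Im s > pi}" "V = {s. Im s < - pi} \<inter> {s. Im s > - 3 * pi}"
    by (auto simp: S_def U_def V_def)
  hence op: "open S" "open U" "open V" by (simp_all add: open_Int open_halfspace_Im_lt open_halfspace_Im_gt)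
  have hQ: "dsine \<alpha> holomorphic_on S"
    unfolding dsine_def using holomorphic_log_dsine[of 1 \<alpha>] \<alpha>
    by (auto intro!: holomorphic_intros simp: S_def r_def)
  have hQ': "(\<lambda>w. inverse (dsine \<alpha> w)) holomorphic_on S"
    by (rule holomorphic_on_inverse[OF hQ]) (simp add: dsine_def)
  define fA where "fA = (\<lambda>w. dsine \<alpha> (w - 2 * of_real pi * \<i>) * (1 + exp (- of_real \<alpha> * (w - \<i> * of_real pi))))"
  define fB where "fB = (\<lambda>w. inverse (dsine \<alpha> (w + 2 * of_real pi * \<i>)) * (1 + exp (- of_real \<alpha> * (w + \<i> * of_real pi))))"
  have "(\<lambda>w. dsine \<alpha> (w - 2 * of_real pi * \<i>)) holomorphic_on U"
    by (rule holomorphic_on_compose_gen[unfolded o_def, OF _ hQ]) (use r in \<open>auto intro!: holomorphic_intros simp: U_def S_def\<close>)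
  hence hA: "fA holomorphic_on U" unfolding fA_def by (intro holomorphic_intros)
  have "(\<lambda>w. inverse (dsine \<alpha> (w + 2 * of_real pi * \<i>))) holomorphic_on V"
    by (rule holomorphic_on_compose_gen[unfolded o_def, OF _ hQ']) (use r in \<open>auto intro!: holomorphic_intros simp: V_def S_def\<close>)
  hence hB: "fB holomorphic_on V" unfolding fB_def by (rule holomorphic_on_mult) (intro holomorphic_intros)
  have eqA: "dsine \<alpha> w = fA w" if "w \<in> S" "w \<in> U" for w
    using dsine_shift[OF \<alpha>, of "w - \<i> * of_real pi"] that
    by (simp add: S_def U_def r_def fA_def algebra_simps)
  have eqB: "inverse (dsine \<alpha> w) = fB w" if "w \<in> S" "w \<in> V" for w
  proof -
    have im: "\<bar>Im (w + \<i> * of_real pi)\<bar> < pi / \<alpha>" using that by (auto simp: S_def V_def r_def)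
    have nz: "1 + exp (- of_real \<alpha> * (w + \<i> * of_real pi)) \<noteq> 0"
    proof (rule one_plus_exp_notin_nonpos_Reals(2))
      have "\<bar>Im (- of_real \<alpha> * (w + \<i> * of_real pi))\<bar> = \<alpha> * \<bar>Im (w + \<i> * of_real pi)\<bar>"
        using \<alpha> by (simp add: abs_mult flip: distrib_left)
      also have "\<dots> < \<alpha> * (pi / \<alpha>)" using im \<alpha> by (intro mult_strict_left_mono) auto
      finally show "\<bar>Im (- of_real \<alpha> * (w + \<i> * of_real pi))\<bar> < pi" using \<alpha> by simp
    qed
    have "dsine \<alpha> (w + 2 * of_real pi * \<i>) = dsine \<alpha> w * (1 + exp (- of_real \<alpha> * (w + \<i> * of_real pi)))"
      using dsine_shift[OF \<alpha> im] by (simp add: algebra_simps)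
    thus ?thesis unfolding fB_def using nz by simp
  qed
  show ?thesis
  proof (rule that)
    have "(\<lambda>w. if w \<in> S then dsine \<alpha> w else fA w) holomorphic_on (S \<union> U)"
      by (rule holomorphic_on_If_Un[OF hQ hA op(1,2) eqA])
    thus "(\<lambda>w. if w \<in> S then dsine \<alpha> w else fA w) holomorphic_on {w. - pi < Im w \<and> Im w < 3 * pi}"
      by (rule holomorphic_on_subset) (use r in \<open>auto simp: S_def U_def\<close>)
    have "(\<lambda>w. if w \<in> S then inverse (dsine \<alpha> w) else fB w) holomorphic_on (S \<union> V)"
      by (rule holomorphic_on_If_Un[OF hQ' hB op(1,3) eqB])
    thus "(\<lambda>w. if w \<in> S then inverse (dsine \<alpha> w) else fB w) holomorphic_on {w. - 3 * pi < Im w \<and> Im w < pi}"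
      by (rule holomorphic_on_subset) (use r in \<open>auto simp: S_def V_def\<close>)
  qed (use r in \<open>auto simp: S_def\<close>)
qed

text \<open>
  For \<open>\<bar>Arg z\<bar> < \<pi>\<close> the points \<open>\<pi>\<i>\<rho> - Ln z\<close> and \<open>-\<pi>\<i>\<rho> - Ln z\<close> lie in the domains of the upward and the
  downward continuation. All singularities of the quotient are thus collected in the reciprocal of
  one holomorphic function.
\<close>
lemma phi_pos_nicely_meromorphic_extension:
  assumes \<alpha>: "\<alpha> > 0" and \<rho>: "0 < \<rho>" "\<rho> < 1"
  obtains f where "f nicely_meromorphic_on (- \<real>\<^sub>\<le>\<^sub>0)" "\<And>x. x > 0 \<Longrightarrow> f (of_real x) = phi_pos \<alpha> \<rho> x"
proof -
  obtain A B where A: "A holomorphic_on {w. - pi < Im w \<and> Im w < 3 * pi}"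
    and B: "B holomorphic_on {w. - 3 * pi < Im w \<and> Im w < pi}"
    and A_eq: "\<And>w. \<bar>Im w\<bar> < pi \<Longrightarrow> A w = dsine \<alpha> w"
    and B_eq: "\<And>w. \<bar>Im w\<bar> < pi \<Longrightarrow> B w = inverse (dsine \<alpha> w)"
    by (rule dsine_continuations[OF \<alpha>]) blast
  define h where "h = (\<lambda>z. A (\<i> * of_real (pi * \<rho>) - Ln z) * B (- \<i> * of_real (pi * \<rho>) - Ln z))"
  have y: "0 < pi * \<rho>" "pi * \<rho> < pi" using \<rho> by auto
  have im: "- pi < Im (Ln z)" "Im (Ln z) < pi" if "z \<in> - \<real>\<^sub>\<le>\<^sub>0" for z
  proof -
    have "z \<noteq> 0" using that by auto
    thus "- pi < Im (Ln z)" "Im (Ln z) < pi" using that Im_Ln_less_pi[of z] mpi_less_Im_Ln[of z] by auto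
  qed
  have "(\<lambda>z. A (\<i> * of_real (pi * \<rho>) - Ln z)) holomorphic_on (- \<real>\<^sub>\<le>\<^sub>0)"
  proof (rule holomorphic_on_compose_gen[unfolded o_def, OF _ A])
    show "(\<lambda>z. \<i> * of_real (pi * \<rho>) - Ln z) ` (- \<real>\<^sub>\<le>\<^sub>0) \<subseteq> {w. - pi < Im w \<and> Im w < 3 * pi}"
    proof (rule image_subsetI)
      fix z :: complex assume "z \<in> - \<real>\<^sub>\<le>\<^sub>0"
      moreover have "Im (\<i> * of_real (pi * \<rho>) - Ln z) = pi * \<rho> - Im (Ln z)" by simp
      ultimately show "\<i> * of_real (pi * \<rho>) - Ln z \<in> {w. - pi < Im w \<and> Im w < 3 * pi}"
        using im[of z] y unfolding mem_Collect_eq by linarith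
    qed
  qed (auto intro!: holomorphic_intros)
  moreover have "(\<lambda>z. B (- \<i> * of_real (pi * \<rho>) - Ln z)) holomorphic_on (- \<real>\<^sub>\<le>\<^sub>0)"
  proof (rule holomorphic_on_compose_gen[unfolded o_def, OF _ B])
    show "(\<lambda>z. - \<i> * of_real (pi * \<rho>) - Ln z) ` (- \<real>\<^sub>\<le>\<^sub>0) \<subseteq> {w. - 3 * pi < Im w \<and> Im w < pi}"
    proof (rule image_subsetI)
      fix z :: complex assume "z \<in> - \<real>\<^sub>\<le>\<^sub>0"
      moreover have "Im (- \<i> * of_real (pi * \<rho>) - Ln z) = - (pi * \<rho>) - Im (Ln z)" by simp
      ultimately show "- \<i> * of_real (pi * \<rho>) - Ln z \<in> {w. - 3 * pi < Im w \<and> Im w < pi}"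
        using im[of z] y unfolding mem_Collect_eq by linarith
    qed
  qed (auto intro!: holomorphic_intros)
  ultimately have "h holomorphic_on (- \<real>\<^sub>\<le>\<^sub>0)" unfolding h_def by (intro holomorphic_intros)
  hence h: "h analytic_on (- \<real>\<^sub>\<le>\<^sub>0)" by (subst analytic_on_open) (auto simp: open_Compl)
  have val: "inverse (h (of_real x)) = phi_pos \<alpha> \<rho> x" if x: "x > 0" for x
  proof -
    have "Ln (of_real x) = of_real (ln x)" using x by (simp add: Ln_of_real)
    hence "h (of_real x) = dsine \<alpha> (\<i> * of_real (pi * \<rho>) - of_real (ln x)) * inverse (dsine \<alpha> (- \<i> * of_real (pi * \<rho>) - of_real (ln x)))"
      unfolding h_def using y by (subst A_eq, simp, subst B_eq) auto
    also have "inverse \<dots> = exp (log_phi \<alpha> \<rho> (of_real (ln x)))"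
    proof -
      have inv: "inverse (exp p * inverse (exp q)) = exp (q - p)" for p q :: complex
        by (simp add: exp_diff field_simps)
      show ?thesis
        unfolding dsine_def inv log_phi_def by (simp only: diff_divide_distrib[symmetric] minus_diff_eq)
    qed
    finally show ?thesis using phi_pos_eq_exp_log_phi[OF \<alpha> \<rho> x] by simp
  qed
  show ?thesis
  proof (rule that)
    have "(\<lambda>z. inverse (h z)) meromorphic_on (- \<real>\<^sub>\<le>\<^sub>0)"
      by (intro meromorphic_on_inverse analytic_on_imp_meromorphic_on h)
    thus "remove_sings (\<lambda>z. inverse (h z)) nicely_meromorphic_on (- \<real>\<^sub>\<le>\<^sub>0)"
      by (rule remove_sings_nicely_meromorphic)
    fix x :: real assume x: "x > 0"
    have "inverse (h (of_real x)) \<noteq> 0" unfolding val[OF x] by (simp add: phi_pos_def)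
    hence "(\<lambda>z. inverse (h z)) analytic_on {of_real x}"
      using x by (intro analytic_on_inverse analytic_on_subset[OF h]) auto
    thus "remove_sings (\<lambda>z. inverse (h z)) (of_real x) = phi_pos \<alpha> \<rho> x"
      using val[OF x] by simp
  qed
qed

section \<open>The series on the slit unit disc\<close>

text \<open>
  Multiplying by \<open>exp (- h)\<close> keeps the function nicely meromorphic, and the identity theorem applies
  to the constant \<open>1\<close>.
\<close>
lemma nicely_meromorphic_eq_exp:
  assumes f: "f nicely_meromorphic_on U" and h: "h holomorphic_on U" and U: "open U" "connected U"
    and z0: "z0 \<in> U" "\<exists>\<^sub>F z in at z0. f z = exp (h z)" and z: "z \<in> U"
  shows "f z = exp (h z)"
proof -
  define k where "k = (\<lambda>z. f z * exp (- h z))"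
  have e: "(\<lambda>z. exp (- h z)) analytic_on U"
    using U h by (subst analytic_on_open) (auto intro!: holomorphic_intros)
  have "k nicely_meromorphic_on U"
    unfolding nicely_meromorphic_on_def
  proof (intro conjI ballI)
    show "k meromorphic_on U" unfolding k_def
      using f by (intro meromorphic_on_mult analytic_on_imp_meromorphic_on[OF e]) (auto simp: nicely_meromorphic_on_def)
    fix w assume w: "w \<in> U"
    have ew: "(\<lambda>z. exp (- h z)) analytic_on {w}" using e w by (auto intro: analytic_on_subset)
    have "(is_pole f w \<and> f w = 0) \<or> f \<midarrow>w\<rightarrow> f w"
      using f w by (auto simp: nicely_meromorphic_on_def)
    thus "(is_pole k w \<and> k w = 0) \<or> k \<midarrow>w\<rightarrow> k w"
    proof
      assume "is_pole f w \<and> f w = 0"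
      hence "is_pole k w \<and> k w = 0"
        unfolding k_def using is_pole_mult_analytic_nonzero2[OF _ ew] by auto
      thus ?thesis ..
    next
      assume "f \<midarrow>w\<rightarrow> f w"
      moreover have "(\<lambda>z. exp (- h z)) \<midarrow>w\<rightarrow> exp (- h w)"
        using analytic_at_imp_isCont[OF ew] by (simp add: isCont_def)
      ultimately have "k \<midarrow>w\<rightarrow> k w" unfolding k_def by (intro tendsto_mult)
      thus ?thesis ..
    qed
  qed
  moreover have "\<exists>\<^sub>F z in at z0. k z = 1"
    using z0(2) by (rule frequently_elim1) (simp add: k_def flip: exp_add)
  ultimately have "k z = 1" using U z0(1) z frequently_eq_meromorphic_imp_constant[where f = k and c = 1 and z = z0] by blast
  thus ?thesis by (simp add: k_def exp_minus field_simps)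
qed

text \<open>
  This turns the difference of two values of \<open>log_dsine\<close> in \<open>log_phi\<close> into the series with the
  quotients of sines; \<open>y = \<rho>\<close>, \<open>x = 1/\<alpha>\<close> gives the first series and \<open>y = \<alpha>\<rho>\<close>, \<open>x = \<alpha>\<close> the second.
\<close>
lemma cosec_series_difference_sums:
  assumes x: "subexp_sin_lower_bound x" and u: "norm u < 1"
  shows "(\<lambda>n. let k = Suc n in of_real (sin (pi * real k * y) / (real k * sin (pi * real k * x))) * (-1) ^ k * u ^ k) sums
    (- (cosec_series x (u * exp (- \<i> * of_real (pi * y))) - cosec_series x (u * exp (\<i> * of_real (pi * y)))) / (2 * of_real pi * \<i>))"
proof -
  have n: "norm (u * exp (- \<i> * of_real (pi * y))) < 1" "norm (u * exp (\<i> * of_real (pi * y))) < 1"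
    using u by (auto simp: norm_mult)
  define f where "f = (\<lambda>k. - (cosec_coeff x k * (u * exp (- \<i> * of_real (pi * y))) ^ k - cosec_coeff x k * (u * exp (\<i> * of_real (pi * y))) ^ k) / (2 * of_real pi * \<i>))"
  define S where "S = - (cosec_series x (u * exp (- \<i> * of_real (pi * y))) - cosec_series x (u * exp (\<i> * of_real (pi * y)))) / (2 * of_real pi * \<i>)"
  have "f sums S"
    unfolding f_def S_def by (intro sums_divide sums_minus sums_diff cosec_series_sums[OF x] n)
  moreover have "f 0 = 0" by (simp add: f_def)
  ultimately have "(\<lambda>n. f (Suc n)) sums S" using sums_Suc_iff[of f S] by simp
  moreover have "f k = of_real (sin (pi * real k * y) / (real k * sin (pi * real k * x))) * (-1) ^ k * u ^ k" for k
  proof -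
    have e: "exp (- \<i> * of_real (pi * y)) ^ k = exp (- (\<i> * of_real (pi * real k * y)))"
            "exp (\<i> * of_real (pi * y)) ^ k = exp (\<i> * of_real (pi * real k * y))"
      unfolding exp_of_nat_mult[symmetric] by (simp_all add: mult_ac)
    have s: "exp (- (\<i> * of_real (pi * real k * y))) - exp (\<i> * of_real (pi * real k * y)) = - 2 * \<i> * of_real (sin (pi * real k * y))"
      unfolding sin_of_real[symmetric] sin_exp_eq by simp
    have "f k = - (cosec_coeff x k * u ^ k * (exp (- (\<i> * of_real (pi * real k * y))) - exp (\<i> * of_real (pi * real k * y)))) / (2 * of_real pi * \<i>)"
      unfolding f_def power_mult_distrib e by (simp add: algebra_simps)
    also have "\<dots> = of_real (sin (pi * real k * y)) * (cosec_coeff x k / of_real pi) * u ^ k"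
      unfolding s by simp
    also have "cosec_coeff x k / of_real pi = (-1) ^ k / of_real (real k * sin (pi * real k * x))"
      unfolding cosec_coeff_def by simp
    finally show ?thesis by simp
  qed
  ultimately show ?thesis by (simp only: S_def Let_def)
qed

text \<open>
  On \<open>0 < x < 1\<close> the formula is the expansion of \<open>log_dsine\<close> at \<open>\<plusminus>\<pi>\<i>\<rho> - ln x\<close>. For complex \<open>z\<close> these points
  may leave the strip where the expansion is available, so the identity theorem carries the formula
  over to the slit disc. Applied to an arbitrary continuation of \<open>phi_pos\<close>, it also shows that the value
  described by \<open>phi\<close> is unique.
\<close>
theorem theorem5:
  fixes \<alpha> \<rho> :: real and z :: complex
  assumes "\<alpha> > 0" and "0 < \<rho>" and "\<rho> < 1"
    and "\<alpha> \<notin> liouville_exp \<union> \<rat>"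
    and "norm z < 1" and "z \<noteq> 0" and "\<bar>Arg z\<bar> < pi"
  shows "\<exists>S T.
    (\<lambda>n. let k = Suc n in
       of_real (sin (pi * real k * \<rho>) / (real k * sin (pi * real k / \<alpha>))) * (-1) ^ k * z ^ k) sums S \<and>
    (\<lambda>n. let k = Suc n in
       of_real (sin (pi * real k * \<alpha> * \<rho>) / (real k * sin (pi * real k * \<alpha>))) * (-1) ^ k *
       z powr of_real (\<alpha> * real k)) sums T \<and>
    phi \<alpha> \<rho> z = exp (S + T)"
proof -
  note \<alpha> = assms(1) and \<rho> = assms(2,3)
  have irr: "\<alpha> \<notin> \<rat>" "\<alpha> \<notin> liouville_exp" using assms(4) by auto
  have x1: "subexp_sin_lower_bound \<alpha>" and x2: "subexp_sin_lower_bound (1 / \<alpha>)"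
    using subexp_sin_lower_bound_self subexp_sin_lower_bound_inverse \<alpha> irr by auto
  define U where "U = ball 0 1 - (\<real>\<^sub>\<le>\<^sub>0 :: complex set)"
  have U_subset: "U \<subseteq> - \<real>\<^sub>\<le>\<^sub>0" by (auto simp: U_def)
  define P where "P = (\<lambda>w. exp (of_real \<alpha> * Ln w))"
  have norm_P: "norm (P w) < 1" if "w \<noteq> 0" "norm w < 1" for w
    using that \<alpha> by (simp add: P_def mult_pos_neg)
  define S where "S = (\<lambda>w. - (cosec_series (1 / \<alpha>) (w * exp (- \<i> * of_real (pi * \<rho>))) - cosec_series (1 / \<alpha>) (w * exp (\<i> * of_real (pi * \<rho>)))) / (2 * of_real pi * \<i>))"
  define T where "T = (\<lambda>w. - (cosec_series \<alpha> (P w * exp (- \<i> * of_real (pi * (\<alpha> * \<rho>)))) - cosec_series \<alpha> (P w * exp (\<i> * of_real (pi * (\<alpha> * \<rho>))))) / (2 * of_real pi * \<i>))"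
  have zU: "z \<in> U"
  proof -
    have "z \<notin> \<real>\<^sub>\<le>\<^sub>0"
    proof
      assume "z \<in> \<real>\<^sub>\<le>\<^sub>0"
      hence "Arg z = pi" using assms(6) by (auto simp: Arg_eq_pi complex_nonpos_Reals_iff complex_eq_iff)
      thus False using assms(7) by simp
    qed
    thus ?thesis using assms(5) by (simp add: U_def)
  qed
  have oU: "open U" unfolding U_def by (intro open_Diff) auto
  \<comment> \<open>The slit disc is the image under \<open>exp\<close> of a convex half-strip.\<close>
  have cU: "connected U"
  proof -
    have "U = exp ` {w. Re w < 0 \<and> - pi < Im w \<and> Im w < pi}"
    proof (intro equalityI subsetI)
      fix w assume w: "w \<in> U"
      hence "w \<noteq> 0" by (auto simp: U_def)
      have "ln (norm w) < 0" using w \<open>w \<noteq> 0\<close> by (simp add: U_def)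
      hence "Ln w \<in> {w. Re w < 0 \<and> - pi < Im w \<and> Im w < pi}"
        using \<open>w \<noteq> 0\<close> w Im_Ln_less_pi[of w] mpi_less_Im_Ln[of w] by (auto simp: U_def)
      thus "w \<in> exp ` {w. Re w < 0 \<and> - pi < Im w \<and> Im w < pi}"
        using \<open>w \<noteq> 0\<close> by (intro image_eqI[of _ _ "Ln w"]) auto
    next
      fix w assume "w \<in> exp ` {w. Re w < 0 \<and> - pi < Im w \<and> Im w < (pi::real)}"
      then obtain v where v: "w = exp v" "Re v < 0" "- pi < Im v" "Im v < pi" by auto
      have "w \<notin> \<real>\<^sub>\<le>\<^sub>0"
      proof
        assume "w \<in> \<real>\<^sub>\<le>\<^sub>0"
        moreover have "w \<noteq> 0" using v by simp
        ultimately have "Im (Ln w) = pi" by (auto simp: Im_Ln_eq_pi complex_nonpos_Reals_iff complex_eq_iff)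
        thus False using v Ln_exp[of v] by auto
      qed
      thus "w \<in> U" using v by (simp add: U_def)
    qed
    also have "connected \<dots>"
    proof (rule connected_continuous_image)
      have eq: "{w. Re w < 0 \<and> - pi < Im w \<and> Im w < pi} = {w. Re w < 0} \<inter> ({w. Im w > - pi} \<inter> {w. Im w < pi})" by auto
      show "connected {w. Re w < 0 \<and> - pi < Im w \<and> Im w < pi}"
        unfolding eq by (intro convex_connected convex_Int convex_halfspace_Re_lt convex_halfspace_Im_lt convex_halfspace_Im_gt)
    qed (intro continuous_intros)
    finally show ?thesis .
  qed
  have nz: "w \<noteq> 0" "norm w < 1" "w \<notin> \<real>\<^sub>\<le>\<^sub>0" if "w \<in> U" for w using that by (auto simp: U_def)
  have hol: "(\<lambda>w. S w + T w) holomorphic_on U"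
  proof -
    have 1: "(\<lambda>w. cosec_series (1 / \<alpha>) (w * exp c)) holomorphic_on U" if "Re c = 0" for c
      by (rule holomorphic_on_compose_gen[unfolded o_def, OF _ cosec_series_holomorphic[OF x2]])
         (use nz that in \<open>auto intro!: holomorphic_intros simp: norm_mult\<close>)
    have 2: "(\<lambda>w. cosec_series \<alpha> (P w * exp c)) holomorphic_on U" if "Re c = 0" for c
    proof (rule holomorphic_on_compose_gen[unfolded o_def, OF _ cosec_series_holomorphic[OF x1]])
      show "(\<lambda>w. P w * exp c) holomorphic_on U"
        unfolding P_def using nz by (intro holomorphic_intros) auto
      show "(\<lambda>w. P w * exp c) ` U \<subseteq> ball 0 1" using norm_P nz that by (auto simp: norm_mult)
    qed
    show ?thesis unfolding S_def T_def by (intro holomorphic_intros 1 2) auto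
  qed
  have pos: "phi_pos \<alpha> \<rho> x = exp (S (of_real x) + T (of_real x))" if x: "0 < x" "x < 1" for x
  proof -
    have im: "\<bar>pi * \<rho>\<bar> < pi + pi / \<alpha>"
    proof -
      have "pi * \<rho> < pi" "0 < pi * \<rho>" "0 < pi / \<alpha>" using \<rho> \<alpha> by auto
      thus ?thesis by linarith
    qed
    define p where "p = \<i> * of_real (pi * \<rho>) - complex_of_real (ln x)"
    define m where "m = - \<i> * of_real (pi * \<rho>) - complex_of_real (ln x)"
    have pm: "0 < Re p" "\<bar>Im p\<bar> < pi + pi / \<alpha>" "0 < Re m" "\<bar>Im m\<bar> < pi + pi / \<alpha>"
      using x im by (auto simp: p_def m_def)
    have "Ln (of_real x) = of_real (ln x)" using x by (simp add: Ln_of_real)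
    hence P: "P (of_real x) = exp (of_real \<alpha> * of_real (ln x))" by (simp add: P_def)
    have X: "complex_of_real x = exp (of_real (ln x))" using x by (simp add: exp_of_real)
    have e: "exp (- p) = of_real x * exp (- \<i> * of_real (pi * \<rho>))" "exp (- m) = of_real x * exp (\<i> * of_real (pi * \<rho>))"
      "exp (- of_real \<alpha> * p) = P (of_real x) * exp (- \<i> * of_real (pi * (\<alpha> * \<rho>)))"
      "exp (- of_real \<alpha> * m) = P (of_real x) * exp (\<i> * of_real (pi * (\<alpha> * \<rho>)))"
      unfolding P p_def m_def by (simp_all add: X algebra_simps flip: exp_add)
    have "log_phi \<alpha> \<rho> (of_real (ln x)) = - (log_dsine 1 \<alpha> p - log_dsine 1 \<alpha> m) / (2 * of_real pi * \<i>)"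
      by (simp add: log_phi_def p_def m_def)
    also have "\<dots> = S (of_real x) + T (of_real x)"
      unfolding log_dsine_series[OF \<alpha> irr pm(1,2)] log_dsine_series[OF \<alpha> irr pm(3,4)] S_def T_def e
      by (simp add: add_divide_distrib[symmetric])
    finally show ?thesis using phi_pos_eq_exp_log_phi[OF \<alpha> \<rho> x(1)] by simp
  qed
  have key: "f z = exp (S z + T z)" if f: "f nicely_meromorphic_on (- \<real>\<^sub>\<le>\<^sub>0)" "\<forall>x>0. f (of_real x) = phi_pos \<alpha> \<rho> x" for f
  proof (rule nicely_meromorphic_eq_exp[OF nicely_meromorphic_on_subset[OF f(1) U_subset] hol oU cU _ _ zU])
    show "complex_of_real (1 / 2) \<in> U" by (simp add: U_def complex_nonpos_Reals_iff)
    have "(1 / 2) islimpt {0<..<1::real}" by (rule open_imp_islimpt) auto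
    moreover have "\<forall>\<^sub>F y in at (1 / 2). complex_of_real y \<noteq> complex_of_real (1 / 2)"
      unfolding of_real_eq_iff by (rule eventually_neq_at_within)
    ultimately have "complex_of_real (1 / 2) islimpt complex_of_real ` {0<..<1}"
      by (intro islimpt_isCont_image) auto
    thus "\<exists>\<^sub>F w in at (complex_of_real (1 / 2)). f w = exp (S w + T w)"
      unfolding islimpt_conv_frequently_at by (rule frequently_elim1) (use f(2) pos in auto)
  qed
  have phi: "phi \<alpha> \<rho> z = exp (S z + T z)"
    unfolding phi_def
  proof (rule the_equality)
    obtain f where "f nicely_meromorphic_on (- \<real>\<^sub>\<le>\<^sub>0)" "\<And>x. x > 0 \<Longrightarrow> f (of_real x) = phi_pos \<alpha> \<rho> x"
      by (rule phi_pos_nicely_meromorphic_extension[OF \<alpha> \<rho>]) blast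
    thus "\<exists>f. f nicely_meromorphic_on (- \<real>\<^sub>\<le>\<^sub>0) \<and> (\<forall>x>0. f (of_real x) = phi_pos \<alpha> \<rho> x) \<and> exp (S z + T z) = f z"
      using key[of f] by auto
  qed (use key in auto)
  have "(\<lambda>n. let k = Suc n in
       of_real (sin (pi * real k * \<rho>) / (real k * sin (pi * real k / \<alpha>))) * (-1) ^ k * z ^ k) sums S z"
    using cosec_series_difference_sums[OF x2 assms(5), of \<rho>] unfolding S_def by simp
  moreover have "(\<lambda>n. let k = Suc n in
       of_real (sin (pi * real k * \<alpha> * \<rho>) / (real k * sin (pi * real k * \<alpha>))) * (-1) ^ k *
       z powr of_real (\<alpha> * real k)) sums T z"
  proof -
    have "z powr of_real (\<alpha> * real k) = P z ^ k" for k
      using assms(6) by (simp add: powr_def P_def mult_ac flip: exp_of_nat_mult)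
    thus ?thesis
      using cosec_series_difference_sums[OF x1 norm_P[OF assms(6,5)], of "\<alpha> * \<rho>"]
      unfolding T_def by (simp only: mult.assoc)
  qed
  ultimately show ?thesis using phi by blast
qed

end
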